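(* Let $C(x)=\exp\left(\sum_{n=1}^{\infty}\frac{1}{n}\Phi(-\sqrt{n}\,x)\right)$ for $x>0$, where $\Phi$ is the standard normal CDF. In the fixed-budget ranking-and-selection setting of the context, suppose that $\mu_1-\mu_i=\gamma>0$ for all $i=2,\ldots,k$ and $\sigma_i^2=\sigma^2>0$ for all $i=1,\ldots,k$ (for every $k$). Then for any budget $B=ck$ with $c>C(\gamma/\sigma)$, the probability of correct selection of the greedy procedure satisfies $$\lim_{k\to\infty}\mathrm{PCS}=\Pr\left\{\min_{n\ge1}\bar X_1(n)>\mu_1-\gamma_0\right\}=\left[C\left(\frac{\gamma_0}{\sigma}\right)\right]^{-1},$$ where $\gamma_0\in(0,\gamma)$ is the constant satisfying $C\left(\frac{\gamma-\gamma_0}{\sigma}\right)=c$.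
   Context: For each $k\ge2$ there are $k$ alternatives; alternative $i$ produces i.i.d. observations distributed $N(\mu_i,\sigma_i^2)$, independent across alternatives; alternative 1 is the unique best. $\bar X_i(n)$ denotes the sample mean of the first $n$ observations of alternative $i$. Greedy procedure with budget $B$: take one observation from each alternative; then, while the total number of observations is less than $B$, take one more observation from the alternative with the largest current sample mean; at the end select the alternative with the largest sample mean. PCS is the probability that alternative 1 is selected. The limit is taken as $k\to\infty$ with $B=ck$. *)

theory Defs
  imports "HOL-Probability.Probability"
begin

definition Phi :: "real \<Rightarrow> real" where
  "Phi = cdf (density lborel std_normal_density)"

definition greedyC :: "real \<Rightarrow> real" where
  "greedyC x = exp (\<Sum>m. Phi (- sqrt (real (Suc m)) * x) / real (Suc m))"

text \<open>Realisation xs i j = (j+1)-th observation of alternative i+1 (0-based indices).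
  Sample mean of the first n observations of alternative i.\<close>
definition sample_mean :: "(nat \<Rightarrow> nat \<Rightarrow> real) \<Rightarrow> nat \<Rightarrow> nat \<Rightarrow> real" where
  "sample_mean xs i n = (\<Sum>j<n. xs i j) / real n"

text \<open>Alternative (among 0..k-1) with the largest current sample mean, given sample
  sizes cnt; ties (a null event) broken in favour of the smallest index.\<close>
definition best :: "(nat \<Rightarrow> nat \<Rightarrow> real) \<Rightarrow> nat \<Rightarrow> (nat \<Rightarrow> nat) \<Rightarrow> nat" where
  "best xs k cnt = (LEAST i. i < k \<and> (\<forall>j<k. sample_mean xs j (cnt j) \<le> sample_mean xs i (cnt i)))"

fun greedy_counts :: "(nat \<Rightarrow> nat \<Rightarrow> real) \<Rightarrow> nat \<Rightarrow> nat \<Rightarrow> (nat \<Rightarrow> nat)" where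
  "greedy_counts xs k 0 = (\<lambda>i. 1)"
| "greedy_counts xs k (Suc t) =
     (let cnt = greedy_counts xs k t; b = best xs k cnt in cnt(b := cnt b + 1))"

text \<open>Alternative selected by the greedy procedure with k alternatives and budget B:
  after the k initial observations, B - k further observations are taken greedily.\<close>
definition greedy_select :: "(nat \<Rightarrow> nat \<Rightarrow> real) \<Rightarrow> nat \<Rightarrow> nat \<Rightarrow> nat" where
  "greedy_select xs k B = best xs k (greedy_counts xs k (B - k))"

text \<open>Probability of correct selection (alternative 1 = index 0).\<close>
definition PCS :: "'a measure \<Rightarrow> (nat \<Rightarrow> nat \<Rightarrow> 'a \<Rightarrow> real) \<Rightarrow> nat \<Rightarrow> nat \<Rightarrow> real" where
  "PCS M X k B = measure M {\<omega> \<in> space M. greedy_select (\<lambda>i j. X i j \<omega>) k B = 0}"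

end

theory Submission
  imports Defs
begin

text \<open>
  Let \<open>b = \<mu>\<^sub>1 - \<gamma>\<^sub>0\<close>. As long as the sample mean of alternative 1 stays above \<open>b\<close>, each other
  alternative is sampled at most until its own mean first drops to \<open>b\<close>; when alternative 1 has
  dropped below \<open>b\<close> and is preferred again, each other alternative has been sampled at least that
  often. By the law of large numbers these first passage times sum to about \<open>k\<close> times their
  expectation, which equals \<open>c\<close> exactly at the level \<open>b\<close>. Hence, up to events of small probability,
  the selection is correct iff the running mean of alternative 1 never falls below \<open>b\<close>: on that event
  alternative 1 attains its minimal mean after a number of observations not depending on \<open>k\<close>, and
  once it has been sampled beyond this point no other alternative is sampled again.

  Both closed forms come from the Sparre Andersen identity. For the walk \<open>S\<^sub>n\<close> with i.i.d. steps put
  \<open>a\<^sub>n = P(S\<^sub>1,\<dots>,S\<^sub>n > 0)\<close>, \<open>q\<^sub>n = P(S\<^sub>n > 0)\<close>, and let \<open>f\<^sub>j\<close> be the probability that \<open>S\<close> is first positive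
  at time \<open>j\<close>. Time reversal gives \<open>a\<^sub>n = \<Sum>\<^sub>j f\<^sub>j a\<^bsub>n-j\<^esub>\<close>, a cycle argument gives \<open>q\<^sub>n = \<Sum>\<^sub>j j f\<^sub>j a\<^bsub>n-j\<^esub>\<close>, so the
  generating functions satisfy \<open>A' = Q A\<close> with \<open>Q(x) = \<Sum>\<^sub>n q\<^bsub>n+1\<^esub> x\<^sup>n\<close>. For negative drift one may put
  \<open>x = 1\<close>: the expected first passage time \<open>\<Sum> a\<^sub>n\<close> is \<open>exp (\<Sum> q\<^sub>n / n)\<close>, and the probability of never
  becoming positive is its reciprocal.
\<close>

section \<open>Records of a cyclically continued walk\<close>

definition psum :: "(nat \<Rightarrow> real) \<Rightarrow> nat \<Rightarrow> real" where
  "psum z n = (\<Sum>i<n. z i)"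

definition pos_upto :: "nat \<Rightarrow> (nat \<Rightarrow> real) \<Rightarrow> bool" where
  "pos_upto n z \<longleftrightarrow> (\<forall>m\<in>{1..n}. 0 < psum z m)"

definition ladder :: "nat \<Rightarrow> (nat \<Rightarrow> real) \<Rightarrow> bool" where
  "ladder n z \<longleftrightarrow> (\<forall>m<n. psum z m < psum z n)"

definition first_pos :: "nat \<Rightarrow> (nat \<Rightarrow> real) \<Rightarrow> bool" where
  "first_pos j z \<longleftrightarrow> 0 < psum z j \<and> (\<forall>m<j. psum z m \<le> 0)"

text \<open>Indices from \<open>n\<close> on stay fixed, so that the rotation of a finite block is
  an injection of all indices and acts on infinite sequences.\<close>

definition rotate_first :: "nat \<Rightarrow> nat \<Rightarrow> nat \<Rightarrow> nat" where
  "rotate_first n p l = (if l < n then (p + l) mod n else l)"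

lemma psum_0 [simp]: "psum z 0 = 0"
  by (simp add: psum_def)

lemma psum_Suc: "psum z (Suc n) = psum z n + z n"
  by (simp add: psum_def)

lemma psum_shift: "psum (\<lambda>i. z (j + i)) n = psum z (j + n) - psum z j"
  by (induction n) (simp_all add: psum_Suc)

lemma first_pos_unique: "first_pos i z \<Longrightarrow> first_pos j z \<Longrightarrow> i = j"
  unfolding first_pos_def by (metis linorder_neqE_nat not_less)

lemma first_pos_exists:
  assumes "0 < psum z n"
  shows "\<exists>j\<le>n. first_pos j z"
proof -
  let ?j = "LEAST j. 0 < psum z j"
  have "0 < psum z ?j" using assms by (rule LeastI)
  moreover have "?j \<le> n" using assms by (rule Least_le)
  moreover have "\<forall>m<?j. psum z m \<le> 0" using not_less_Least by fastforce
  ultimately show ?thesis unfolding first_pos_def by blast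
qed

text \<open>Before its first positive time \<open>j\<close> the walk is at most 0, hence below its
  value at \<open>j\<close>. Only times from \<open>j\<close> on can prevent \<open>n\<close> from
  being a strict record, so the event splits into a part before \<open>j\<close> and a part after
  it.\<close>

lemma first_pos_ladder_iff:
  assumes "j \<le> n"
  shows "first_pos j z \<and> ladder n z \<longleftrightarrow> first_pos j z \<and> ladder (n - j) (\<lambda>i. z (j + i))"
proof -
  have "ladder n z \<longleftrightarrow> ladder (n - j) (\<lambda>i. z (j + i))" if "first_pos j z"
  proof
    assume "ladder n z"
    then show "ladder (n - j) (\<lambda>i. z (j + i))"
      using assms unfolding ladder_def psum_shift by auto
  next
    assume L: "ladder (n - j) (\<lambda>i. z (j + i))"
    have *: "psum z m < psum z n" if "j \<le> m" "m < n" for m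
      using L[unfolded ladder_def psum_shift, rule_format, of "m - j"] that by auto
    have "psum z j \<le> psum z n"
      using *[of j] assms by (cases "j = n") auto
    then have "psum z m < psum z n" if "m < j" for m
      using that \<open>first_pos j z\<close> unfolding first_pos_def by (smt (verit))
    then show "ladder n z"
      using * unfolding ladder_def by (meson not_le)
  qed
  then show ?thesis by blast
qed

lemma ladder_psum_pos: "0 < n \<Longrightarrow> ladder n z \<Longrightarrow> 0 < psum z n"
  unfolding ladder_def by (metis psum_0)

text \<open>For a walk repeated with period \<open>n\<close> and positive increment per period,
  \<open>p + n\<close> is a record time and \<open>j\<close> is the length of the record interval
  opened at \<open>p\<close>. Only times from \<open>p\<close> on are mentioned, so the conditions
  can be read off the rotated walk.\<close>

definition cyclic_ladder :: "(nat \<Rightarrow> real) \<Rightarrow> nat \<Rightarrow> nat \<Rightarrow> nat \<Rightarrow> bool" where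
  "cyclic_ladder V n p j \<longleftrightarrow> (\<forall>l<n. V (p + l) < V (p + n)) \<and> V p < V (p + j) \<and> (\<forall>l<j. V (p + l) \<le> V p)"

text \<open>The start of the record interval containing a given time is the first maximiser of
  the walk over the preceding period.\<close>

lemma ex1_cyclic_ladder:
  fixes V :: "nat \<Rightarrow> real"
  assumes per: "\<And>m. V (m + n) = V m + D" and "0 < D" and "0 < n"
  shows "\<exists>!pj. fst pj < n \<and> snd pj \<le> n \<and> n \<le> fst pj + snd pj \<and> cyclic_ladder V n (fst pj) (snd pj)"
proof -
  \<comment> \<open>An admissible \<open>p\<close> must be the first maximiser over
    \<open>{..<n}\<close>: from \<open>p\<close> to \<open>n - 1\<close> the walk has not yet risen
    above \<open>V p\<close>, because \<open>n \<le> p + j\<close>; a time before \<open>p\<close>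
    is moved by one period into the window after \<open>p\<close>, where the record condition is
    strict.\<close>
  have first_max: "(\<forall>l<n. V l \<le> V p) \<and> (\<forall>l<p. V l < V p)"
    if "p < n" "n \<le> p + j" "cyclic_ladder V n p j" for p j
  proof -
    have 1: "V l \<le> V p" if "p \<le> l" "l < n" for l
      using \<open>cyclic_ladder V n p j\<close> that \<open>n \<le> p + j\<close> unfolding cyclic_ladder_def
      by (metis add_le_cancel_left le_add_diff_inverse linorder_not_le order_le_less_trans)
    have 2: "V l < V p" if "l < p" for l
    proof -
      have "V (p + (l + n - p)) < V (p + n)"
        using \<open>cyclic_ladder V n p j\<close>[unfolded cyclic_ladder_def, THEN conjunct1, rule_format, of "l + n - p"]
          that \<open>p < n\<close> by simp
      then show ?thesis using that \<open>p < n\<close> per[of l] per[of p] by auto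
    qed
    show ?thesis using 1 2 by (meson leI less_imp_le)
  qed
  have uniq: "pj = pj'"
    if "fst pj < n \<and> snd pj \<le> n \<and> n \<le> fst pj + snd pj \<and> cyclic_ladder V n (fst pj) (snd pj)"
      and "fst pj' < n \<and> snd pj' \<le> n \<and> n \<le> fst pj' + snd pj' \<and> cyclic_ladder V n (fst pj') (snd pj')"
    for pj pj'
  proof -
    obtain p j p' j' where eq: "pj = (p, j)" "pj' = (p', j')" by (metis surj_pair)
    have "p = p'"
      using first_max[of p j] first_max[of p' j'] that unfolding eq
      by (metis fst_conv snd_conv linorder_neqE_nat not_less)
    moreover from this have "j = j'"
      using that unfolding eq cyclic_ladder_def fst_conv snd_conv
      by (metis linorder_neqE_nat not_less)
    ultimately show ?thesis unfolding eq by simp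
  qed
  define Mx where "Mx = Max (V ` {..<n})"
  have Mx: "V l \<le> Mx" if "l < n" for l unfolding Mx_def using that by auto
  have "Mx \<in> V ` {..<n}" unfolding Mx_def using \<open>0 < n\<close> by (intro Max_in) auto
  then obtain p0 where p0: "V p0 = Mx" "p0 < n" by auto
  define p where "p = (LEAST p. V p = Mx)"
  have p: "V p = Mx" unfolding p_def using p0(1) by (rule LeastI)
  have "p \<le> p0" unfolding p_def using p0(1) by (rule Least_le)
  then have "p < n" using p0 by simp
  have less_p: "V l < Mx" if "l < p" for l
    using Mx[of l] not_less_Least[of l "\<lambda>p. V p = Mx"] that \<open>p < n\<close> unfolding p_def by fastforce
  define j where "j = (LEAST j. V p < V (p + j))"
  have n: "V p < V (p + n)" using per \<open>0 < D\<close> by simp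
  have j: "V p < V (p + j)" unfolding j_def using n by (rule LeastI)
  have "j \<le> n" unfolding j_def using n by (rule Least_le)
  have less_j: "V (p + l) \<le> V p" if "l < j" for l
    using not_less_Least[of l "\<lambda>j. V p < V (p + j)"] that unfolding j_def by fastforce
  have "n \<le> p + j"
    using Mx[of "p + j"] j p by (meson not_le)
  \<comment> \<open>Up to time \<open>n - 1\<close> maximality of \<open>V p\<close> suffices. Later
    times are pulled back by one period, where \<open>p\<close> being the first maximiser gives
    strictness.\<close>
  have "V (p + l) < V (p + n)" if "l < n" for l
  proof (cases "p + l < n")
    case True
    then show ?thesis using Mx[of "p + l"] p n by linarith
  next
    case False
    then have "V (p + l) = V (p + l - n) + D" using per[of "p + l - n"] by simp
    moreover have "V (p + l - n) < V p" using less_p[of "p + l - n"] p that False by simp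
    ultimately show ?thesis using per[of p] by simp
  qed
  then have "cyclic_ladder V n p j"
    using j less_j unfolding cyclic_ladder_def by blast
  then show ?thesis
    using uniq \<open>p < n\<close> \<open>j \<le> n\<close> \<open>n \<le> p + j\<close> by (intro ex_ex1I exI[of _ "(p, j)"]) simp_all
qed

lemma psum_mod_period:
  assumes "0 < n"
  shows "psum (\<lambda>t. z (t mod n)) (m + n) = psum (\<lambda>t. z (t mod n)) m + psum z n"
proof (induction m)
  case 0
  show ?case by (simp add: psum_def)
qed (simp add: psum_Suc)

lemma psum_rotate_first:
  assumes "l \<le> n"
  shows "psum (\<lambda>i. z (rotate_first n p i)) l = psum (\<lambda>t. z (t mod n)) (p + l) - psum (\<lambda>t. z (t mod n)) p"
proof -
  have "psum (\<lambda>i. z (rotate_first n p i)) l = psum (\<lambda>i. z ((p + i) mod n)) l"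
    using assms unfolding psum_def by (intro sum.cong) (auto simp: rotate_first_def)
  then show ?thesis using psum_shift[of "\<lambda>t. z (t mod n)" p l] by simp
qed

lemma cyclic_ladder_iff:
  assumes "0 < n" "j \<le> n"
  shows "cyclic_ladder (psum (\<lambda>t. z (t mod n))) n p j \<longleftrightarrow>
    first_pos j (\<lambda>i. z (rotate_first n p i)) \<and> ladder n (\<lambda>i. z (rotate_first n p i))"
  using assms unfolding cyclic_ladder_def first_pos_def ladder_def
  by (auto simp: psum_rotate_first)

lemma cyclic_ladder_psum_pos:
  assumes "0 < n" "cyclic_ladder (psum (\<lambda>t. z (t mod n))) n p j"
  shows "0 < psum z n"
  using assms(2)[unfolded cyclic_ladder_def, THEN conjunct1, rule_format, of 0] assms(1)
  by (simp add: psum_mod_period)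

text \<open>Injectivity is what lets \<open>measure_reindex\<close> conclude that rotating the steps
  does not change their law.\<close>

lemma inj_rotate_first: "inj (rotate_first n p)"
proof (rule linorder_injI)
  fix x y :: nat
  assume "x < y"
  have "(p + x) mod n \<noteq> (p + y) mod n" if "y < n"
  proof
    assume "(p + x) mod n = (p + y) mod n"
    then have "n dvd (p + y) - (p + x)"
      using \<open>x < y\<close> by (subst mod_eq_dvd_iff_nat[symmetric]) auto
    then show False using \<open>x < y\<close> that by (auto dest!: dvd_imp_le)
  qed
  moreover have "(p + x) mod n \<noteq> y" if "x < n" "\<not> y < n"
    using that mod_less_divisor[of n "p + x"] by auto
  ultimately show "rotate_first n p x \<noteq> rotate_first n p y"
    using \<open>x < y\<close> by (auto simp: rotate_first_def)
qed

section \<open>The Sparre Andersen identity\<close>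

locale real_sequence_space = sequence_space D for D :: "real measure" +
  assumes sets_D [measurable_cong, simp]: "sets D = sets borel"
begin

lemma space_D [simp]: "space D = UNIV"
  using sets_eq_imp_space_eq[OF sets_D] by simp

lemma space_S [simp]: "space S = UNIV"
  by (simp add: space_PiM)

lemma pred_sets [intro]: "Measurable.pred S Q \<Longrightarrow> {z. Q z} \<in> sets S"
  by (simp add: pred_def)

lemma coord_measurable [measurable]: "(\<lambda>z. z i) \<in> borel_measurable S"
  using measurable_component_singleton[of i UNIV "\<lambda>_. D"] measurable_cong_sets[OF refl sets_D] by blast

lemma psum_measurable [measurable]: "(\<lambda>z. psum z n) \<in> borel_measurable S"
  unfolding psum_def by measurable

lemma pred_pos_upto [measurable]: "Measurable.pred S (pos_upto n)"
  unfolding pos_upto_def by measurable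

lemma pred_ladder [measurable]: "Measurable.pred S (ladder n)"
  unfolding ladder_def by measurable

lemma pred_first_pos [measurable]: "Measurable.pred S (first_pos n)"
  unfolding first_pos_def by measurable

lemma reindex_measurable: "(\<lambda>z i. z (t i)) \<in> measurable S S"
  by (rule measurable_PiM_single') (auto simp: measurable_cong_sets[OF refl sets_D])

lemma pred_reindex: "Measurable.pred S Q \<Longrightarrow> Measurable.pred S (\<lambda>z. Q (\<lambda>i. z (t i)))"
  by (rule measurable_compose[OF reindex_measurable])

text \<open>With i.i.d. coordinates, reading them along an injection leaves the product measure
  unchanged. Time reversal and rotation are the two instances.\<close>

lemma measure_reindex:
  assumes "inj t" and [measurable]: "Measurable.pred S Q"
  shows "measure S {z. Q (\<lambda>i. z (t i))} = measure S {z. Q z}"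
proof -
  have "distr S S (\<lambda>z i. z (t i)) = S"
    using distr_PiM_reindex[of UNIV "\<lambda>_. D" t UNIV] \<open>inj t\<close> M.prob_space_axioms
    by (simp add: restrict_def)
  then have "measure S {z. Q z} = measure (distr S S (\<lambda>z i. z (t i))) {z. Q z}" by simp
  also have "\<dots> = measure S {z. Q (\<lambda>i. z (t i))}"
    using assms(2) by (subst measure_distr) (simp_all add: vimage_def pred_sets reindex_measurable)
  finally show ?thesis by simp
qed

text \<open>Gluing the first \<open>j\<close> entries of one sample to an independent second sample
  reproduces the product measure. On the glued sequence \<open>Q\<close> sees only the first sample
  and \<open>R\<close> only the second.\<close>

lemma measure_indep_shift:
  assumes [measurable]: "Measurable.pred S Q" "Measurable.pred S R"
    and Q: "\<And>z z'. (\<And>i. i < j \<Longrightarrow> z i = z' i) \<Longrightarrow> Q z \<longleftrightarrow> Q z'"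
  shows "measure S {z. Q z \<and> R (\<lambda>i. z (j + i))} = measure S {z. Q z} * measure S {z. R z}"
proof -
  let ?C = "\<lambda>(z, z'). comb_seq j z z'"
  note [measurable] = pred_reindex[OF assms(2), of "\<lambda>i. j + i"]
  have "measure S {z. Q z \<and> R (\<lambda>i. z (j + i))} =
      measure (distr (S \<Otimes>\<^sub>M S) S ?C) {z. Q z \<and> R (\<lambda>i. z (j + i))}"
    by (simp add: PiM_comb_seq)
  also have "\<dots> = measure (S \<Otimes>\<^sub>M S) (?C -` {z. Q z \<and> R (\<lambda>i. z (j + i))} \<inter> space (S \<Otimes>\<^sub>M S))"
    by (intro measure_distr measurable_comb_seq pred_sets) measurable
  also have "?C -` {z. Q z \<and> R (\<lambda>i. z (j + i))} \<inter> space (S \<Otimes>\<^sub>M S) = {z. Q z} \<times> {z. R z}"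
  proof -
    have "Q (comb_seq j z z') \<longleftrightarrow> Q z" for z z' by (rule Q) (simp add: comb_seq_def)
    moreover have "(\<lambda>i. comb_seq j z z' (j + i)) = z'" for z z' :: "nat \<Rightarrow> real"
      by (simp add: comb_seq_def)
    ultimately show ?thesis by (auto simp: space_pair_measure)
  qed
  also have "measure (S \<Otimes>\<^sub>M S) ({z. Q z} \<times> {z. R z}) = measure S {z. Q z} * measure S {z. R z}"
    using pred_sets[OF assms(1)] pred_sets[OF assms(2)]
    by (simp add: measure_def P.emeasure_pair_measure_Times enn2real_mult pred_sets)
  finally show ?thesis .
qed

section \<open>Renewal and cyclic decompositions\<close>

definition "prob_pos_upto n = measure S {z. pos_upto n z}"
definition "prob_pos n = measure S {z. 0 < psum z n}"
definition "prob_first n = measure S {z. first_pos n z}"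

text \<open>Reversing the first \<open>n\<close> steps turns ladder times into positivity of all partial sums.\<close>

lemma prob_ladder: "measure S {z. ladder n z} = prob_pos_upto n"
proof -
  define t where "t i = (if i < n then n - Suc i else i)" for i
  have "inj t" by (rule injI) (auto simp: t_def split: if_splits)
  have rev: "psum (\<lambda>i. z (t i)) m = psum z n - psum z (n - m)" if "m \<le> n" for z m
    using that
  proof (induction m)
    case (Suc m)
    then have "n - m = Suc (n - Suc m)" by simp
    then have "psum z (n - m) = psum z (n - Suc m) + z (n - Suc m)" by (simp only: psum_Suc)
    then show ?case using Suc by (simp add: psum_Suc t_def)
  qed simp
  have "pos_upto n (\<lambda>i. z (t i)) \<longleftrightarrow> ladder n z" for z
  proof
    assume L: "pos_upto n (\<lambda>i. z (t i))"
    show "ladder n z" unfolding ladder_def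
    proof safe
      fix m assume "m < n"
      then show "psum z m < psum z n"
        using L[unfolded pos_upto_def, rule_format, of "n - m"] rev[of "n - m" z] by auto
    qed
  qed (auto simp: pos_upto_def ladder_def rev)
  then show ?thesis
    using measure_reindex[OF \<open>inj t\<close>, of "pos_upto n"] by (simp add: prob_pos_upto_def)
qed

lemma prob_first_ladder:
  assumes "j \<le> n"
  shows "measure S {z. first_pos j z \<and> ladder n z} = prob_first j * prob_pos_upto (n - j)"
proof -
  have "measure S {z. first_pos j z \<and> ladder n z} =
      measure S {z. first_pos j z \<and> ladder (n - j) (\<lambda>i. z (j + i))}"
    using first_pos_ladder_iff[OF assms] by simp
  also have "\<dots> = measure S {z. first_pos j z} * measure S {z. ladder (n - j) z}"
  proof (rule measure_indep_shift)
    fix z z' :: "nat \<Rightarrow> real" assume "\<And>i. i < j \<Longrightarrow> z i = z' i"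
    then have "psum z m = psum z' m" if "m \<le> j" for m
      using that unfolding psum_def by (intro sum.cong) auto
    then show "first_pos j z = first_pos j z'" by (auto simp: first_pos_def)
  qed measurable
  finally show ?thesis by (simp add: prob_ladder prob_first_def)
qed

text \<open>A record time \<open>n > 0\<close> has a unique first positive time
  \<open>j \<le> n\<close>. Splitting at it gives a convolution, the coefficient form of A = 1 + F
  A.\<close>

lemma prob_pos_upto_renewal:
  assumes "0 < n"
  shows "prob_pos_upto n = (\<Sum>j\<le>n. prob_first j * prob_pos_upto (n - j))"
proof -
  have "{z. ladder n z} = (\<Union>j\<in>{..n}. {z. first_pos j z \<and> ladder n z})"
    using first_pos_exists ladder_psum_pos[OF assms] by blast
  then have "prob_pos_upto n = measure S (\<Union>j\<in>{..n}. {z. first_pos j z \<and> ladder n z})"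
    using prob_ladder[of n] by simp
  also have "\<dots> = (\<Sum>j\<le>n. measure S {z. first_pos j z \<and> ladder n z})"
    by (rule P.finite_measure_finite_Union)
      (auto simp: disjoint_family_on_def dest: first_pos_unique)
  finally show ?thesis by (simp add: prob_first_ladder)
qed

text \<open>Exactly one record interval of the periodically continued walk covers the origin; a record
  interval of length \<open>j\<close> can be rotated to \<open>j\<close> positions.\<close>

lemma prob_pos_cyclic:
  assumes "0 < n"
  shows "prob_pos n = (\<Sum>j\<le>n. real j * prob_first j * prob_pos_upto (n - j))"
proof -
  \<comment> \<open>Length \<open>j\<close> and start \<open>p\<close> with
    \<open>p < n \<le> p + j\<close>: the record interval reaches over time \<open>n\<close>, which
    is the origin modulo \<open>n\<close>. Each \<open>j\<close> admits exactly \<open>j\<close>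
    such starts.\<close>
  define I where "I = (SIGMA j:{..n}. {n - j..<n})"
  define E where "E = (\<lambda>(j, p). {z. first_pos j (\<lambda>i. z (rotate_first n p i)) \<and> ladder n (\<lambda>i. z (rotate_first n p i))})"
  have I_iff: "x \<in> I \<longleftrightarrow> snd x < n \<and> fst x \<le> n \<and> n \<le> snd x + fst x" for x
    by (cases x) (auto simp: I_def)
  have E_iff: "z \<in> E x \<longleftrightarrow> cyclic_ladder (psum (\<lambda>t. z (t mod n))) n (snd x) (fst x)" if "x \<in> I" for x z
    using cyclic_ladder_iff[OF assms] that by (auto simp: E_def I_iff split: prod.splits)
  have un: "\<exists>!x. x \<in> I \<and> z \<in> E x" if z: "0 < psum z n" for z
  proof -
    from ex1_cyclic_ladder[of "psum (\<lambda>t. z (t mod n))", OF psum_mod_period[OF assms] z assms] obtain y where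
      y: "fst y < n \<and> snd y \<le> n \<and> n \<le> fst y + snd y \<and>
         cyclic_ladder (psum (\<lambda>t. z (t mod n))) n (fst y) (snd y)"
      and uniq: "\<And>y'. fst y' < n \<and> snd y' \<le> n \<and> n \<le> fst y' + snd y' \<and>
         cyclic_ladder (psum (\<lambda>t. z (t mod n))) n (fst y') (snd y') \<Longrightarrow> y' = y"
      by (elim ex1E) blast
    show ?thesis
    proof (rule ex1I[of _ "prod.swap y"])
      show "prod.swap y \<in> I \<and> z \<in> E (prod.swap y)" using y by (auto simp: I_iff E_iff)
      fix x assume "x \<in> I \<and> z \<in> E x"
      then have "prod.swap x = y" by (intro uniq) (auto simp: E_iff, auto simp: I_iff)
      then show "x = prod.swap y" by (metis swap_swap)
    qed
  qed
  have pos: "0 < psum z n" if "x \<in> I" "z \<in> E x" for x z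
    using that cyclic_ladder_psum_pos[OF assms] by (auto simp: E_iff)
  have "{z. 0 < psum z n} = (\<Union>x\<in>I. E x)" using un pos by blast
  then have "prob_pos n = measure S (\<Union>x\<in>I. E x)" by (simp add: prob_pos_def)
  also have "\<dots> = (\<Sum>x\<in>I. measure S (E x))"
  proof (rule P.finite_measure_finite_Union)
    show "finite I" by (simp add: I_def)
    show "E ` I \<subseteq> sets S" unfolding E_def
      using pred_sets[OF pred_reindex[of "\<lambda>z. first_pos j z \<and> ladder n z" for j]] by auto
    show "disjoint_family_on E I" unfolding disjoint_family_on_def using un pos by blast
  qed
  \<comment> \<open>By invariance under rotation the probability does not depend on the start;
    summing over the starts then produces the factor \<open>j\<close>.\<close>
  also have "\<dots> = (\<Sum>x\<in>I. prob_first (fst x) * prob_pos_upto (n - fst x))"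
  proof (rule sum.cong[OF refl])
    fix x assume "x \<in> I"
    then show "measure S (E x) = prob_first (fst x) * prob_pos_upto (n - fst x)"
      using measure_reindex[OF inj_rotate_first, of "\<lambda>z. first_pos (fst x) z \<and> ladder n z" n "snd x"]
        prob_first_ladder[of "fst x" n] by (auto simp: E_def I_iff split: prod.splits)
  qed
  also have "\<dots> = (\<Sum>j\<le>n. \<Sum>p\<in>{n - j..<n}. prob_first j * prob_pos_upto (n - j))"
    unfolding I_def by (subst sum.Sigma) (auto simp: split_beta)
  also have "\<dots> = (\<Sum>j\<le>n. real j * prob_first j * prob_pos_upto (n - j))"
    by (intro sum.cong) (auto simp: mult.assoc)
  finally show ?thesis .
qed

lemma prob_pos_upto_0 [simp]: "prob_pos_upto 0 = 1"
  using P.prob_space by (simp add: prob_pos_upto_def pos_upto_def)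

lemma prob_first_0 [simp]: "prob_first 0 = 0"
  by (simp add: prob_first_def first_pos_def)

end

text \<open>The recursion says A' = B' A for the power series with coefficients \<open>a n\<close>
  and \<open>q n / n\<close>. Geometric decay gives a radius of convergence above 1, so A exp(-B) is
  constant on [0,1] and can be evaluated at both ends.\<close>

lemma suminf_eq_exp_suminf:
  fixes a q :: "nat \<Rightarrow> real"
  assumes a0: "a 0 = 1" and q0: "q 0 = 0"
    and rec: "\<And>n. real (Suc n) * a (Suc n) = (\<Sum>i\<le>n. q (Suc i) * a (n - i))"
    and a: "\<And>n. norm (a n) \<le> K * r ^ n" and q: "\<And>n. norm (q n) \<le> K * r ^ n"
    and r: "0 < r" "r < 1"
  shows "(\<Sum>n. a n) = exp (\<Sum>n. q (Suc n) / real (Suc n))"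
proof -
  have "0 \<le> K" using order_trans[OF norm_ge_zero a[of 0]] by simp
  \<comment> \<open>\<open>R\<close> is the reciprocal of the midpoint of \<open>r\<close> and 1,
    hence lies strictly between 1 and \<open>1 / r\<close>.\<close>
  define R where "R = 2 / (1 + r)"
  have R: "1 < R" "r * R < 1" "0 < R" using r by (auto simp: R_def field_simps)
  have geom: "summable (\<lambda>n. c n * x ^ n)"
    if c: "\<And>n. norm (c n) \<le> K * r ^ n" and x: "norm x \<le> R" for c :: "nat \<Rightarrow> real" and x :: real
  proof (rule summable_comparison_test')
    show "summable (\<lambda>n. K * (r * R) ^ n)"
      using R r by (intro summable_mult summable_geometric) simp
    fix n :: nat
    have "norm (c n * x ^ n) = norm (c n) * norm x ^ n" by (simp add: abs_mult power_abs)
    also have "\<dots> \<le> (K * r ^ n) * R ^ n"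
      using c x \<open>0 \<le> K\<close> r by (intro mult_mono power_mono) auto
    finally show "norm (c n * x ^ n) \<le> K * (r * R) ^ n"
      by (simp add: power_mult_distrib mult.assoc)
  qed
  \<comment> \<open>Division by zero makes \<open>b 0 = 0\<close>, and \<open>diffs b n\<close> is
    \<open>q (Suc n)\<close>.\<close>
  define b where "b n = q n / real n" for n
  have b: "norm (b n) \<le> K * r ^ n" for n
  proof (cases n)
    case (Suc m)
    have "norm (q n) * 1 \<le> norm (q n) * real n" unfolding Suc by (intro mult_left_mono) auto
    then have "norm (b n) \<le> norm (q n)" by (simp add: b_def Suc divide_le_eq)
    then show ?thesis using q[of n] by linarith
  qed (use \<open>0 \<le> K\<close> in \<open>simp add: b_def\<close>)
  define A where "A x = (\<Sum>n. a n * x ^ n)" for x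
  define B where "B x = (\<Sum>n. b n * x ^ n)" for x
  have dA: "DERIV A x :> (\<Sum>n. diffs a n * x ^ n)" if "norm x < R" for x
    unfolding A_def by (rule termdiffs_strong[OF geom[OF a, of R]]) (use that R in auto)
  have dB: "DERIV B x :> (\<Sum>n. diffs b n * x ^ n)" if "norm x < R" for x
    unfolding B_def by (rule termdiffs_strong[OF geom[OF b, of R]]) (use that R in auto)
  have abs_geom: "summable (\<lambda>n. norm (c n * x ^ n))"
    if c: "\<And>n. norm (c n) \<le> K * r ^ n" and x: "norm x \<le> R" for c :: "nat \<Rightarrow> real" and x :: real
    using geom[of "\<lambda>n. norm (c n)" "norm x"] that by (simp add: abs_mult power_abs)
  \<comment> \<open>Absolute convergence of the shifted series is obtained by dividing by
    \<open>norm x\<close>, hence \<open>x \<noteq> 0\<close>. Zero enters later only as an endpoint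
    of the interval, where continuity is enough.\<close>
  have prod: "(\<Sum>n. diffs a n * x ^ n) = (\<Sum>n. diffs b n * x ^ n) * A x" if x: "norm x < R" "x \<noteq> 0" for x
  proof -
    have "summable (\<lambda>n. norm (q (Suc n) * x ^ Suc n))"
      using abs_geom[OF q, of x] x by (subst summable_Suc_iff) simp
    then have "summable (\<lambda>n. norm (q (Suc n) * x ^ Suc n) / norm x)"
      by (rule summable_divide)
    then have sq: "summable (\<lambda>n. norm (q (Suc n) * x ^ n))"
      using x by (simp add: abs_mult)
    have "(\<Sum>n. diffs b n * x ^ n) * A x = (\<Sum>n. q (Suc n) * x ^ n) * (\<Sum>n. a n * x ^ n)"
      by (simp add: diffs_def b_def A_def)
    also have "\<dots> = (\<Sum>n. \<Sum>i\<le>n. (q (Suc i) * x ^ i) * (a (n - i) * x ^ (n - i)))"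
      using x by (intro Cauchy_product sq abs_geom[OF a]) simp
    also have "(\<lambda>n. \<Sum>i\<le>n. (q (Suc i) * x ^ i) * (a (n - i) * x ^ (n - i))) = (\<lambda>n. diffs a n * x ^ n)"
    proof
      fix n
      have "(\<Sum>i\<le>n. (q (Suc i) * x ^ i) * (a (n - i) * x ^ (n - i))) = (\<Sum>i\<le>n. (q (Suc i) * a (n - i)) * x ^ n)"
        by (intro sum.cong) (simp_all add: power_add[symmetric] mult_ac)
      then show "(\<Sum>i\<le>n. (q (Suc i) * x ^ i) * (a (n - i) * x ^ (n - i))) = diffs a n * x ^ n"
        using rec[of n] by (simp add: sum_distrib_right[symmetric] diffs_def)
    qed
    finally show ?thesis by simp
  qed
  define G where "G x = A x * exp (- B x)" for x
  have dG: "DERIV G x :> 0" if "norm x < R" "x \<noteq> 0" for x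
    unfolding G_def using prod[OF that]
    by (auto intro!: derivative_eq_intros dA dB that simp: algebra_simps)
  have cont: "continuous_on {0..1} G"
  proof (intro continuous_at_imp_continuous_on ballI)
    fix x :: real assume "x \<in> {0..1}"
    then have "norm x < R" using R by auto
    then show "isCont G x" unfolding G_def
      by (intro continuous_intros DERIV_isCont[OF dA] DERIV_isCont[OF dB])
  qed
  have "G 1 = G 0"
    by (rule DERIV_isconst_end[OF zero_less_one cont]) (use R in \<open>auto intro!: dG\<close>)
  moreover have "G 0 = 1"
    using powser_zero[of a] powser_zero[of b] by (simp add: G_def A_def B_def a0 b_def)
  ultimately have "G 1 = 1" by simp
  then have "A 1 = exp (B 1)"
    by (simp add: G_def exp_minus field_simps)
  moreover have "B 1 = (\<Sum>n. b (Suc n))"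
  proof -
    have "summable b" using geom[OF b, of 1] R by simp
    moreover have "b 0 = 0" by (simp add: b_def)
    ultimately show ?thesis using suminf_split_head[of b] by (simp add: B_def)
  qed
  ultimately show ?thesis by (simp add: A_def b_def)
qed

context real_sequence_space
begin

text \<open>As formal power series, F A = A - 1 and Q = F' A. Differentiating the first gives F A' =
  A' - Q; multiplying by A and replacing F A by A - 1 leaves A' = Q A. No convergence is
  involved.\<close>

lemma prob_pos_upto_recurrence:
  "real (Suc n) * prob_pos_upto (Suc n) = (\<Sum>i\<le>n. prob_pos (Suc i) * prob_pos_upto (n - i))"
proof -
  define A where "A = Abs_fps prob_pos_upto"
  define F where "F = Abs_fps prob_first"
  define Q where "Q = Abs_fps (\<lambda>n. prob_pos (Suc n))"
  have renewal: "F * A = A - 1"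
  proof (rule fps_ext)
    fix n show "fps_nth (F * A) n = fps_nth (A - 1) n"
      using prob_pos_upto_renewal[of n, symmetric]
      by (cases "n = 0") (simp_all add: A_def F_def fps_mult_nth atLeast0AtMost)
  qed
  have cyclic: "Q = fps_deriv F * A"
  proof (rule fps_ext)
    fix n
    have "prob_pos (Suc n) = (\<Sum>j\<le>n. real (Suc j) * prob_first (Suc j) * prob_pos_upto (n - j))"
      using prob_pos_cyclic[of "Suc n"] by (simp add: sum.atMost_Suc_shift del: sum.atMost_Suc)
    then show "fps_nth Q n = fps_nth (fps_deriv F * A) n"
      by (simp add: Q_def A_def F_def fps_mult_nth atLeast0AtMost)
  qed
  have "fps_deriv (F * A) = fps_deriv A"
    unfolding renewal by simp
  then have d: "F * fps_deriv A = fps_deriv A - fps_deriv F * A"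
    by (simp add: algebra_simps)
  have "(A - 1) * fps_deriv A = A * (F * fps_deriv A)"
    unfolding renewal[symmetric] by (simp only: mult_ac)
  then have "fps_deriv A = Q * A"
    unfolding d cyclic by (simp add: algebra_simps)
  from arg_cong[OF this, of "\<lambda>f. fps_nth f n"] show ?thesis
    by (simp add: A_def Q_def fps_mult_nth atLeast0AtMost)
qed

lemma prob_pos_upto_le: "0 < n \<Longrightarrow> prob_pos_upto n \<le> prob_pos n"
  unfolding prob_pos_upto_def prob_pos_def
  by (intro P.finite_measure_mono pred_sets subsetI) (simp add: pos_upto_def, measurable)

lemma prob_first_le: "prob_first n \<le> prob_pos n"
  unfolding prob_first_def prob_pos_def
  by (intro P.finite_measure_mono pred_sets subsetI) (simp add: first_pos_def, measurable)

section \<open>Walks with geometrically decaying positivity probabilities\<close>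

context
  fixes K r :: real
  assumes decay: "\<And>n. prob_pos n \<le> K * r ^ n" and K: "1 \<le> K" and r: "0 < r" "r < 1"
begin

lemma summable_decay:
  assumes "\<And>n. norm (c n) \<le> K * r ^ n"
  shows "summable (c :: nat \<Rightarrow> real)"
proof (rule summable_comparison_test'[OF _ assms])
  show "summable (\<lambda>n. K * r ^ n)"
    using r by (intro summable_mult summable_geometric) simp
qed

text \<open>For positive \<open>n\<close> the decay is inherited from \<open>prob_pos\<close>. The
  case \<open>n = 0\<close>, where the value is 1, is covered by \<open>1 \<le> K\<close>.\<close>

lemma prob_pos_upto_decay: "norm (prob_pos_upto n) \<le> K * r ^ n"
proof (cases "n = 0")
  case False
  then have "prob_pos_upto n \<le> K * r ^ n"
    using prob_pos_upto_le[of n] decay[of n] by linarith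
  then show ?thesis by (simp add: prob_pos_upto_def)
qed (use K in simp)

lemma summable_prob_pos_upto: "summable prob_pos_upto"
  by (rule summable_decay) (rule prob_pos_upto_decay)

theorem suminf_prob_pos_upto:
  "(\<Sum>n. prob_pos_upto n) = exp (\<Sum>n. prob_pos (Suc n) / real (Suc n))"
proof (rule suminf_eq_exp_suminf[where K = K and r = r])
  show "prob_pos 0 = 0" by (simp add: prob_pos_def)
  show "norm (prob_pos n) \<le> K * r ^ n" for n
    using decay[of n] by (simp add: prob_pos_def)
qed (fact prob_pos_upto_0 prob_pos_upto_recurrence prob_pos_upto_decay r)+

text \<open>The sought probability is 1 - F(1). The renewal equation summed over \<open>n\<close>
  reads F(1) A(1) = A(1) - 1, the 1 coming from \<open>n = 0\<close>, where the convolution is 0.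
  Hence (1 - F(1)) A(1) = 1.\<close>

theorem prob_never_pos:
  "measure S {z. \<forall>n. psum z n \<le> 0} = exp (- (\<Sum>n. prob_pos (Suc n) / real (Suc n)))"
proof -
  have f_decay: "norm (prob_first n) \<le> K * r ^ n" for n
    using prob_first_le[of n] decay[of n] by (simp add: prob_first_def)
  have "(\<lambda>n. prob_first n) sums measure S (\<Union>n. {z. first_pos n z})"
    unfolding prob_first_def
    by (intro P.finite_measure_UNION) (auto simp: disjoint_family_on_def dest: first_pos_unique)
  moreover have "(\<Union>n. {z. first_pos n z}) = UNIV - {z. \<forall>n. psum z n \<le> 0}"
  proof (intro equalityI subsetI)
    fix z assume "z \<in> (\<Union>n. {z. first_pos n z})"
    then obtain n where "0 < psum z n" by (auto simp: first_pos_def)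
    then show "z \<in> UNIV - {z. \<forall>n. psum z n \<le> 0}" by (auto simp: not_le)
  next
    fix z assume "z \<in> UNIV - {z. \<forall>n. psum z n \<le> 0}"
    then obtain n where "0 < psum z n" by (auto simp: not_le)
    then show "z \<in> (\<Union>n. {z. first_pos n z})" using first_pos_exists by blast
  qed
  moreover have "measure S (UNIV - {z. \<forall>n. psum z n \<le> 0}) = 1 - measure S {z. \<forall>n. psum z n \<le> 0}"
  proof -
    have "{z. \<forall>n. psum z n \<le> 0} \<in> sets S" by (rule pred_sets) measurable
    then show ?thesis using P.prob_compl[of "{z. \<forall>n. psum z n \<le> 0}"] by simp
  qed
  ultimately have F: "(\<Sum>n. prob_first n) = 1 - measure S {z. \<forall>n. psum z n \<le> 0}"
    by (simp add: sums_iff)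
  have "(\<Sum>n. prob_first n) * (\<Sum>n. prob_pos_upto n) = (\<Sum>n. \<Sum>i\<le>n. prob_first i * prob_pos_upto (n - i))"
    by (intro Cauchy_product summable_decay)
      (use f_decay prob_pos_upto_decay in \<open>simp_all only: real_norm_def abs_idempotent\<close>)
  also have "\<dots> = (\<Sum>n. prob_pos_upto n - (if n = 0 then 1 else 0))"
  proof (rule suminf_cong)
    fix n show "(\<Sum>i\<le>n. prob_first i * prob_pos_upto (n - i)) = prob_pos_upto n - (if n = 0 then 1 else 0)"
      using prob_pos_upto_renewal[of n, symmetric] by (cases "n = 0") simp_all
  qed
  also have "\<dots> = (\<Sum>n. prob_pos_upto n) - (\<Sum>n. if n = 0 then 1 else 0)"
    by (intro suminf_diff[symmetric] summable_prob_pos_upto) (rule summable_single)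
  also have "(\<Sum>n::nat. if n = 0 then 1 else 0 :: real) = 1"
    using sums_single[of 0 "\<lambda>_. 1::real"] by (simp add: sums_iff)
  finally have "measure S {z. \<forall>n. psum z n \<le> 0} * (\<Sum>n. prob_pos_upto n) = 1"
    using F by (simp add: algebra_simps)
  then show ?thesis
    unfolding suminf_prob_pos_upto by (simp add: exp_minus field_simps)
qed

end

end

section \<open>Gaussian walks with negative drift\<close>

interpretation std_normal: real_distribution "density lborel std_normal_density"
  by (rule real_dist_normal_dist)

lemma null_set_density_lborel_singleton:
  assumes [measurable]: "f \<in> borel_measurable borel"
  shows "{x::real} \<in> null_sets (density lborel f)"
  using absolutely_continuousI_density[of f lborel] finite_imp_null_set_lborel[of "{x}"]
  by (auto simp: absolutely_continuous_def)

lemma isCont_Phi: "isCont Phi x"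
  unfolding Phi_def std_normal.isCont_cdf
  using null_set_density_lborel_singleton[of "\<lambda>x. ennreal (std_normal_density x)" x]
  by (simp add: measure_eq_0_null_sets)

lemma Phi_nonneg: "0 \<le> Phi x"
  by (simp add: Phi_def cdf_def)

text \<open>The density vanishes nowhere, so an interval that is null for the normal law would be
  null for Lebesgue measure.\<close>

lemma Phi_strict_mono: "x < y \<Longrightarrow> Phi x < Phi y"
proof -
  assume "x < y"
  have "{x<..y} \<notin> null_sets (density lborel std_normal_density)"
  proof
    assume "{x<..y} \<in> null_sets (density lborel std_normal_density)"
    then have "AE t in lborel. t \<in> {x<..y} \<longrightarrow> ennreal (std_normal_density t) = 0"
      by (subst (asm) null_sets_density_iff) auto
    moreover have "ennreal (std_normal_density t) \<noteq> 0" for t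
      using normal_density_pos[of 1 0 t] by (simp add: ennreal_eq_0_iff)
    ultimately have "AE t in lborel. t \<notin> {x<..y}" by simp
    then have "{x<..y} \<in> null_sets lborel" by (subst AE_iff_null_sets) auto
    then show False using \<open>x < y\<close> by (auto simp: null_sets_def)
  qed
  then have "0 < measure (density lborel std_normal_density) {x<..y}"
    by (simp add: std_normal.emeasure_eq_measure null_sets_def zero_less_measure_iff)
  then show ?thesis
    using std_normal.cdf_diff_eq[OF \<open>x < y\<close>] by (simp add: Phi_def)
qed

text \<open>Completing the square: for \<open>t \<le> - y\<close> the standard density is at most
  \<open>exp (- y\<^sup>2 / 2)\<close> times the density of the normal law centred at
  \<open>- y\<close>, whose total mass is 1.\<close>

lemma Phi_minus_le: "0 \<le> y \<Longrightarrow> Phi (- y) \<le> exp (- y\<^sup>2 / 2)"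
proof -
  assume "0 \<le> y"
  have le: "std_normal_density t * indicator {..- y} t \<le> exp (- y\<^sup>2 / 2) * normal_density (- y) 1 t" for t
  proof (cases "t \<le> - y")
    case True
    then have "0 \<le> y * (- y - t)" using \<open>0 \<le> y\<close> by simp
    then have "- t\<^sup>2 / 2 \<le> - y\<^sup>2 / 2 + - (t + y)\<^sup>2 / 2"
      by (simp add: power2_eq_square algebra_simps)
    then have "exp (- t\<^sup>2 / 2) \<le> exp (- y\<^sup>2 / 2) * exp (- (t + y)\<^sup>2 / 2)"
      unfolding exp_add[symmetric] by (simp only: exp_le_cancel_iff)
    then show ?thesis using True
      by (simp add: normal_density_def divide_right_mono)
  qed simp
  have "emeasure (density lborel std_normal_density) {..- y}
      = (\<integral>\<^sup>+t. ennreal (std_normal_density t * indicator {..- y} t) \<partial>lborel)"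
    by (subst emeasure_density) (auto intro!: nn_integral_cong simp: indicator_def)
  also have "\<dots> \<le> (\<integral>\<^sup>+t. ennreal (exp (- y\<^sup>2 / 2) * normal_density (- y) 1 t) \<partial>lborel)"
    by (intro nn_integral_mono ennreal_leI le)
  also have "\<dots> = (\<integral>\<^sup>+t. ennreal (exp (- y\<^sup>2 / 2)) * ennreal (normal_density (- y) 1 t) \<partial>lborel)"
    by (simp add: ennreal_mult)
  also have "\<dots> = ennreal (exp (- y\<^sup>2 / 2)) * emeasure (density lborel (normal_density (- y) 1)) UNIV"
    by (subst nn_integral_cmult) (auto simp: emeasure_density)
  also have "\<dots> = ennreal (exp (- y\<^sup>2 / 2))"
    using prob_space.emeasure_space_1[OF prob_space_normal_density[of 1 "- y"]] by simp
  finally show ?thesis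
    by (simp add: Phi_def cdf_def std_normal.emeasure_eq_measure)
qed

lemma (in prob_space) normal_prob_pos:
  assumes "distributed M lborel W (normal_density m s)" "0 < s"
  shows "prob {\<omega> \<in> space M. 0 < W \<omega>} = Phi (m / s)"
proof -
  \<comment> \<open>Rescaling to \<open>W / s\<close> and reflecting about the mean turns
    \<open>0 < W\<close> into a lower tail event below \<open>m / s\<close>, the kind of event that
    \<open>Phi\<close> measures.\<close>
  have "distributed M lborel (\<lambda>\<omega>. m / s + (- 1) * ((W \<omega> - m) / s + m / s)) (normal_density (m / s + (- 1) * (m / s)) (\<bar>- 1\<bar> * 1))"
    using normal_density_affine[OF assms, of "1 / s" 0] assms(2)
    by (intro normal_density_affine) (simp_all add: diff_divide_distrib)
  then have V: "distributed M lborel (\<lambda>\<omega>. m / s - W \<omega> / s) std_normal_density"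
    by (simp add: diff_divide_distrib)
  then have distr: "distr M lborel (\<lambda>\<omega>. m / s - W \<omega> / s) = density lborel std_normal_density"
    by (rule distributed_distr_eq_density)
  have [measurable]: "(\<lambda>\<omega>. m / s - W \<omega> / s) \<in> borel_measurable M"
    using distributed_measurable[OF V] by simp
  have "{\<omega> \<in> space M. 0 < W \<omega>} = (\<lambda>\<omega>. m / s - W \<omega> / s) -` {..<m / s} \<inter> space M"
    using assms(2) by (auto simp: zero_less_divide_iff)
  then have "prob {\<omega> \<in> space M. 0 < W \<omega>} = measure (density lborel std_normal_density) {..<m / s}"
    unfolding distr[symmetric] by (subst measure_distr) simp_all
  also have "\<dots> = measure (density lborel std_normal_density) {..m / s}"
  proof -
    have "{..m / s} = {..<m / s} \<union> {m / s}" by auto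
    then show ?thesis
      using null_set_density_lborel_singleton[of "\<lambda>x. ennreal (std_normal_density x)" "m / s"]
      by (simp add: measure_Un_null_set del: Un_insert_right)
  qed
  finally show ?thesis by (simp add: Phi_def cdf_def)
qed

section \<open>Walks with i.i.d. normal steps\<close>

locale gaussian_walk = prob_space +
  fixes Z :: "nat \<Rightarrow> 'a \<Rightarrow> real" and d s :: real
  assumes indep_Z: "indep_vars (\<lambda>_. borel) Z UNIV"
    and distributed_Z: "\<And>j. distributed M lborel (Z j) (normal_density (- d) s)"
    and d_pos: "0 < d" and s_pos: "0 < s"
begin

abbreviation "W n \<omega> \<equiv> psum (\<lambda>j. Z j \<omega>) n"

lemma Z_measurable [measurable]: "Z j \<in> borel_measurable M"
  using distributed_measurable[OF distributed_Z[of j]] by simp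

lemma W_measurable [measurable]: "W n \<in> borel_measurable M"
  unfolding psum_def by measurable

lemma distributed_W:
  assumes "0 < n"
  shows "distributed M lborel (W n) (normal_density (- (real n * d)) (sqrt (real n) * s))"
proof -
  have "distributed M lborel (\<lambda>\<omega>. \<Sum>j<n. Z j \<omega>) (normal_density (\<Sum>j<n. - d) (sqrt (\<Sum>j<n. s\<^sup>2)))"
    using assms s_pos
    by (intro sum_indep_normal indep_vars_subset[OF indep_Z] distributed_Z) auto
  then show ?thesis using s_pos by (simp add: psum_def real_sqrt_mult)
qed

lemma prob_W_pos: "0 < n \<Longrightarrow> prob {\<omega> \<in> space M. 0 < W n \<omega>} = Phi (- (sqrt (real n) * (d / s)))"
proof -
  assume "0 < n"
  have "real n * d / (sqrt (real n) * s) = sqrt (real n) * (d / s)"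
    using real_div_sqrt[of "real n"] by (simp add: times_divide_times_eq[symmetric])
  then show ?thesis
    using normal_prob_pos[OF distributed_W[OF \<open>0 < n\<close>]] \<open>0 < n\<close> s_pos by simp
qed

lemma AE_W_neq:
  assumes "0 < n"
  shows "AE \<omega> in M. W n \<omega> \<noteq> x"
proof -
  have "AE y in distr M lborel (W n). y \<noteq> x"
    unfolding distributed_distr_eq_density[OF distributed_W[OF assms]]
    by (intro AE_I'[OF null_set_density_lborel_singleton]) auto
  then show ?thesis by (subst (asm) AE_distr_iff) auto
qed

definition "D = density lborel (normal_density (- d) s)"

sublocale walk: real_sequence_space D
proof -
  interpret D: prob_space D
    unfolding D_def using s_pos by (rule prob_space_normal_density)
  show "real_sequence_space D"
    by unfold_locales (simp add: D_def)
qed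

text \<open>The identities for walks live on the canonical sequence space. Independence together
  with equal marginals identifies the joint law of the steps with that product measure, which is how
  they are transferred to \<open>M\<close>.\<close>

lemma distr_Z: "distr M walk.S (\<lambda>\<omega> j. Z j \<omega>) = walk.S"
proof -
  have "distr M (\<Pi>\<^sub>M j\<in>UNIV. borel) (\<lambda>\<omega>. \<lambda>j\<in>UNIV. Z j \<omega>) = (\<Pi>\<^sub>M j\<in>UNIV. distr M borel (Z j))"
    using indep_Z by (subst (asm) indep_vars_iff_distr_eq_PiM) auto
  moreover have "distr M borel (Z j) = D" for j
  proof -
    have "distr M borel (Z j) = distr M lborel (Z j)" by (rule distr_cong) simp_all
    then show ?thesis unfolding D_def distributed_distr_eq_density[OF distributed_Z] .
  qed
  moreover have "distr M (\<Pi>\<^sub>M j\<in>UNIV. borel) (\<lambda>\<omega> j. Z j \<omega>) = distr M walk.S (\<lambda>\<omega> j. Z j \<omega>)"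
    by (intro distr_cong sets_PiM_cong) simp_all
  ultimately show ?thesis by (simp add: restrict_def)
qed

lemma prob_walk:
  assumes "Measurable.pred walk.S Q"
  shows "prob {\<omega> \<in> space M. Q (\<lambda>j. Z j \<omega>)} = measure walk.S {z. Q z}"
proof -
  have "(\<lambda>\<omega> j. Z j \<omega>) \<in> measurable M walk.S"
    by (rule measurable_PiM_single') (auto simp: measurable_cong_sets[OF refl walk.sets_D])
  then have "measure (distr M walk.S (\<lambda>\<omega> j. Z j \<omega>)) {z. Q z} = prob {\<omega> \<in> space M. Q (\<lambda>j. Z j \<omega>)}"
    using walk.pred_sets[OF assms]
    by (simp add: measure_distr vimage_def Int_def conj_commute)
  then show ?thesis by (simp add: distr_Z)
qed

text \<open>The tail bound of \<open>Phi_minus_le\<close> at \<open>sqrt n * (d / s)\<close> is the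
  n-th power of this number.\<close>

definition "rate = exp (- (d / s)\<^sup>2 / 2)"

lemma rate: "0 < rate" "rate < 1"
  using d_pos s_pos by (auto simp: rate_def)

lemma prob_pos_eq: "walk.prob_pos (Suc n) = Phi (- sqrt (real (Suc n)) * (d / s))"
  using prob_walk[of "\<lambda>z. 0 < psum z (Suc n)"] prob_W_pos[of "Suc n"]
  by (simp add: walk.prob_pos_def del: of_nat_Suc)

text \<open>The factor 1 is the constant \<open>K\<close> of the decay hypothesis.\<close>

lemma prob_pos_le: "walk.prob_pos n \<le> 1 * rate ^ n"
proof (cases n)
  case 0
  then show ?thesis by (simp add: walk.prob_pos_def)
next
  case (Suc m)
  have "walk.prob_pos n \<le> exp (- (sqrt (real n) * (d / s))\<^sup>2 / 2)"
    using Phi_minus_le[of "sqrt (real n) * (d / s)"] d_pos s_pos unfolding Suc prob_pos_eq by simp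
  also have "\<dots> = rate ^ n"
    by (simp add: rate_def exp_of_nat_mult[symmetric] power_mult_distrib power_divide)
  finally show ?thesis by simp
qed

lemma prob_pos_upto_eq: "prob {\<omega> \<in> space M. pos_upto n (\<lambda>j. Z j \<omega>)} = walk.prob_pos_upto n"
  using prob_walk[of "pos_upto n"] by (simp add: walk.prob_pos_upto_def)

lemma prob_pos_upto_le_rate: "prob {\<omega> \<in> space M. pos_upto n (\<lambda>j. Z j \<omega>)} \<le> rate ^ n"
  using walk.prob_pos_upto_decay[OF prob_pos_le order_refl rate, of n]
  by (simp add: prob_pos_upto_eq[symmetric])

lemma suminf_prob_pos_upto: "(\<Sum>n. prob {\<omega> \<in> space M. pos_upto n (\<lambda>j. Z j \<omega>)}) = greedyC (d / s)"
  using walk.suminf_prob_pos_upto[OF prob_pos_le order_refl rate]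
  unfolding greedyC_def prob_pos_upto_eq prob_pos_eq by simp

lemma prob_never_pos: "prob {\<omega> \<in> space M. \<forall>n. W n \<omega> \<le> 0} = 1 / greedyC (d / s)"
  using walk.prob_never_pos[OF prob_pos_le order_refl rate] prob_walk[of "\<lambda>z. \<forall>n. psum z n \<le> 0"]
  unfolding greedyC_def prob_pos_upto_eq prob_pos_eq by (simp add: exp_minus divide_inverse)

text \<open>Being negative throughout differs from never being positive only on the event that some
  \<open>W n\<close> with \<open>n \<ge> 1\<close> is exactly 0, which is null.\<close>

lemma prob_always_neg: "prob {\<omega> \<in> space M. \<forall>n\<ge>1. W n \<omega> < 0} = 1 / greedyC (d / s)"
proof -
  have "AE \<omega> in M. \<forall>n. 1 \<le> n \<longrightarrow> W n \<omega> \<noteq> 0"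
    using AE_W_neq[of _ 0] by (subst AE_all_countable) auto
  then have "AE \<omega> in M. (\<forall>n\<ge>1. W n \<omega> < 0) \<longleftrightarrow> (\<forall>n. W n \<omega> \<le> 0)"
  proof eventually_elim
    case (elim \<omega>)
    then show ?case by (metis less_eq_real_def less_one not_less psum_0)
  qed
  then have "prob {\<omega> \<in> space M. \<forall>n\<ge>1. W n \<omega> < 0} = prob {\<omega> \<in> space M. \<forall>n. W n \<omega> \<le> 0}"
    by (intro measure_eq_AE) auto
  then show ?thesis by (simp add: prob_never_pos)
qed

end

section \<open>The constant C\<close>

lemma Phi_mono: "x \<le> y \<Longrightarrow> Phi x \<le> Phi y"
  using Phi_strict_mono[of x y] by (cases "x = y") auto

text \<open>The bound is uniform in \<open>x \<ge> x0\<close> and in weights from [0,1]. Weights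
  \<open>1 / Suc m\<close> give the exponent of \<open>greedyC\<close>, weights 1 give
  \<open>Phi_sum\<close>.\<close>

lemma Phi_series_bound:
  assumes "0 < x0" "x0 \<le> x" "0 \<le> w" "w \<le> 1"
  shows "norm (w * Phi (- sqrt (real (Suc m)) * x)) \<le> exp (- x0\<^sup>2 / 2) ^ Suc m"
proof -
  have "w * Phi (- sqrt (real (Suc m)) * x) \<le> 1 * Phi (- sqrt (real (Suc m)) * x)"
    using assms by (intro mult_right_mono Phi_nonneg)
  also have "\<dots> \<le> exp (- (sqrt (real (Suc m)) * x)\<^sup>2 / 2)"
    using Phi_minus_le[of "sqrt (real (Suc m)) * x"] assms by (simp del: of_nat_Suc)
  also have "\<dots> \<le> exp (- (sqrt (real (Suc m)) * x0)\<^sup>2 / 2)"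
    using assms by (simp add: power_mult_distrib mult_left_mono power_mono del: of_nat_Suc)
  also have "\<dots> = exp (- x0\<^sup>2 / 2) ^ Suc m"
    by (simp add: exp_of_nat_mult[symmetric] power_mult_distrib del: of_nat_Suc power_Suc)
  finally show ?thesis using assms Phi_nonneg by simp
qed

lemma summable_exp_power_Suc: "0 < (x0::real) \<Longrightarrow> summable (\<lambda>m. exp (- x0\<^sup>2 / 2) ^ Suc m)"
  by (subst summable_Suc_iff) (simp add: summable_geometric)

lemma summable_Phi_series:
  assumes "0 < x" "\<And>m. 0 \<le> w m" "\<And>m. w m \<le> (1::real)"
  shows "summable (\<lambda>m. w m * Phi (- sqrt (real (Suc m)) * x))"
  by (rule summable_comparison_test'[OF summable_exp_power_Suc[OF assms(1)]])
    (rule Phi_series_bound, use assms in auto)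

lemma isCont_Phi_series:
  assumes "0 < x" "\<And>m. 0 \<le> w m" "\<And>m. w m \<le> (1::real)"
  shows "isCont (\<lambda>x. \<Sum>m. w m * Phi (- sqrt (real (Suc m)) * x)) x"
proof -
  \<comment> \<open>The series converges uniformly only away from 0, so the majorant test is applied
    on the half-line beyond \<open>x / 2\<close>.\<close>
  have lim: "uniform_limit {x / 2<..} (\<lambda>n x. \<Sum>m<n. w m * Phi (- sqrt (real (Suc m)) * x))
      (\<lambda>x. \<Sum>m. w m * Phi (- sqrt (real (Suc m)) * x)) sequentially"
  proof (rule Weierstrass_m_test)
    show "summable (\<lambda>m. exp (- (x / 2)\<^sup>2 / 2) ^ Suc m)"
      by (rule summable_exp_power_Suc) (use assms in simp)
    show "norm (w m * Phi (- sqrt (real (Suc m)) * y)) \<le> exp (- (x / 2)\<^sup>2 / 2) ^ Suc m"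
      if "y \<in> {x / 2<..}" for m y
      by (rule Phi_series_bound) (use assms that in \<open>simp_all only: greaterThan_iff less_imp_le half_gt_zero\<close>)
  qed
  have cont: "continuous_on {x / 2<..} (\<lambda>x. \<Sum>m<n. w m * Phi (- sqrt (real (Suc m)) * x))" for n
  proof -
    have "continuous_on UNIV Phi" by (simp add: continuous_at_imp_continuous_on isCont_Phi)
    then have "continuous_on {x / 2<..} (\<lambda>x. Phi (- sqrt (real (Suc m)) * x))" for m
      by (rule continuous_on_compose2[OF _ _ subset_UNIV])
        (intro continuous_on_mult continuous_on_const continuous_on_id)
    then show ?thesis
      by (intro continuous_on_sum continuous_on_mult continuous_on_const)
  qed
  have "continuous_on {x / 2<..} (\<lambda>x. \<Sum>m. w m * Phi (- sqrt (real (Suc m)) * x))"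
    by (rule uniform_limit_theorem[OF always_eventually[OF allI[OF cont]] lim]) simp
  then have "\<forall>y\<in>{x / 2<..}. isCont (\<lambda>x. \<Sum>m. w m * Phi (- sqrt (real (Suc m)) * x)) y"
    by (simp only: continuous_on_eq_continuous_at[OF open_greaterThan])
  then show ?thesis
    by (rule bspec) (use assms(1) in simp)
qed

lemma greedyC_altdef: "greedyC x = exp (\<Sum>m. (1 / real (Suc m)) * Phi (- sqrt (real (Suc m)) * x))"
  by (simp add: greedyC_def)

lemma summable_greedyC: "0 < x \<Longrightarrow> summable (\<lambda>m. (1 / real (Suc m)) * Phi (- sqrt (real (Suc m)) * x))"
  by (rule summable_Phi_series) auto

lemma isCont_greedyC: "0 < x \<Longrightarrow> isCont greedyC x"
  unfolding greedyC_altdef[abs_def] by (intro isCont_exp' isCont_Phi_series) auto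

lemma greedyC_pos: "0 < greedyC x"
  by (simp add: greedyC_def)

lemma greedyC_ge_1: "0 < x \<Longrightarrow> 1 \<le> greedyC x"
proof -
  assume "0 < x"
  have "0 \<le> (\<Sum>m. (1 / real (Suc m)) * Phi (- sqrt (real (Suc m)) * x))"
    by (intro suminf_nonneg summable_greedyC \<open>0 < x\<close> mult_nonneg_nonneg Phi_nonneg) simp
  then show ?thesis unfolding greedyC_altdef by (simp only: one_le_exp_iff)
qed

text \<open>Every term of the exponent is strictly decreasing, so the difference of the two series
  has only positive terms.\<close>

lemma greedyC_strict_antimono:
  assumes "0 < x" "x < y"
  shows "greedyC y < greedyC x"
proof -
  have "0 < (\<Sum>m. (1 / real (Suc m)) * Phi (- sqrt (real (Suc m)) * x)
      - (1 / real (Suc m)) * Phi (- sqrt (real (Suc m)) * y))"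
    using assms
    by (intro suminf_pos summable_diff summable_greedyC)
      (auto simp: divide_strict_right_mono Phi_strict_mono simp del: of_nat_Suc)
  then show ?thesis
    using assms by (subst (asm) suminf_diff[symmetric]) (auto simp: greedyC_altdef intro!: summable_greedyC[simplified])
qed

text \<open>If \<open>x\<close> is at most \<open>1 / sqrt (real (Suc N))\<close>, each of the first
  \<open>N\<close> normal tails is at least \<open>Phi (- 1)\<close>, so the exponent exceeds that
  constant times a harmonic number, which diverges.\<close>

lemma greedyC_unbounded:
  assumes "0 < y"
  shows "\<exists>x. 0 < x \<and> x < y \<and> K < greedyC x"
proof -
  define p where "p = Phi (- 1)"
  have "0 < p" using Phi_strict_mono[of "- 2" "- 1"] Phi_nonneg[of "- 2"] by (simp add: p_def)
  have "eventually (\<lambda>N. (\<bar>K\<bar> + 1) / p \<le> harm N) sequentially"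
    using harm_at_top by (auto simp: filterlim_at_top)
  then obtain N where N: "(\<bar>K\<bar> + 1) / p \<le> harm N" by (auto simp: eventually_sequentially)
  define x where "x = min (y / 2) (1 / sqrt (real (Suc N)))"
  have x: "0 < x" "x < y" using assms by (auto simp: x_def)
  have le: "sqrt (real (Suc m)) * x \<le> 1" if "m < N" for m
  proof -
    have "sqrt (real (Suc m)) * x \<le> sqrt (real (Suc N)) * (1 / sqrt (real (Suc N)))"
      using that x by (intro mult_mono) (auto simp: x_def)
    then show ?thesis by simp
  qed
  have "\<bar>K\<bar> + 1 \<le> harm N * p"
    using N \<open>0 < p\<close> by (simp add: divide_le_eq)
  also have "\<dots> = (\<Sum>m<N. (1 / real (Suc m)) * p)"
    by (simp add: harm_altdef sum_distrib_right divide_inverse)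
  also have "\<dots> \<le> (\<Sum>m<N. (1 / real (Suc m)) * Phi (- sqrt (real (Suc m)) * x))"
  proof (intro sum_mono mult_left_mono)
    fix m assume "m \<in> {..<N}"
    then have "- 1 \<le> - sqrt (real (Suc m)) * x" using le[of m] by simp
    then show "p \<le> Phi (- sqrt (real (Suc m)) * x)"
      unfolding p_def by (rule Phi_mono)
  qed simp
  also have "\<dots> \<le> (\<Sum>m. (1 / real (Suc m)) * Phi (- sqrt (real (Suc m)) * x))"
    using x by (intro sum_le_suminf summable_greedyC) (auto intro!: divide_nonneg_nonneg Phi_nonneg)
  finally have "exp (\<bar>K\<bar> + 1) \<le> greedyC x"
    unfolding greedyC_altdef by simp
  moreover have "K < exp (\<bar>K\<bar> + 1)"
    using exp_ge_add_one_self[of "\<bar>K\<bar> + 1"] by linarith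
  ultimately show ?thesis using x by auto
qed

lemma greedyC_eq_unique: "0 < x \<Longrightarrow> 0 < y \<Longrightarrow> greedyC x = greedyC y \<Longrightarrow> x = y"
  using greedyC_strict_antimono by (metis linorder_neqE_linordered_idom order_less_irrefl)

lemma greedyC_attains:
  assumes "0 < y" "greedyC y < c"
  shows "\<exists>x. 0 < x \<and> x < y \<and> greedyC x = c"
proof -
  obtain z where z: "0 < z" "z < y" "c < greedyC z" using greedyC_unbounded[OF assms(1)] by blast
  have "\<exists>x\<ge>z. x \<le> y \<and> greedyC x = c"
    by (rule IVT2) (use z assms in \<open>auto intro: isCont_greedyC\<close>)
  then obtain x where "z \<le> x" "x \<le> y" "greedyC x = c" by blast
  then show ?thesis using z assms by (metis less_eq_real_def order_less_irrefl order_less_le_trans)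
qed

section \<open>First passage times\<close>

text \<open>The value is unspecified if the walk stays positive forever; for negative drift that
  event is null.\<close>

definition first_passage :: "(nat \<Rightarrow> real) \<Rightarrow> nat" where
  "first_passage z = (LEAST n. 1 \<le> n \<and> psum z n \<le> 0)"

lemma first_passage_least: "1 \<le> n \<Longrightarrow> psum z n \<le> 0 \<Longrightarrow> first_passage z \<le> n"
  unfolding first_passage_def by (intro Least_le) simp

lemma first_passage_attained:
  assumes "\<exists>n\<ge>1. psum z n \<le> 0"
  shows "1 \<le> first_passage z" "psum z (first_passage z) \<le> 0"
  using LeastI_ex[of "\<lambda>n. 1 \<le> n \<and> psum z n \<le> 0"] assms unfolding first_passage_def by auto

text \<open>This identifies the tail events of the passage time with \<open>pos_upto\<close>, so
  that its expectation becomes the sum of the \<open>prob_pos_upto n\<close>.\<close>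

lemma less_first_passage_iff:
  assumes "\<exists>n\<ge>1. psum z n \<le> 0"
  shows "n < first_passage z \<longleftrightarrow> pos_upto n z"
  using first_passage_attained[OF assms] first_passage_least[of _ z]
  unfolding pos_upto_def by (metis atLeastAtMost_iff linorder_not_le order_le_less_trans)

context gaussian_walk
begin

lemma first_passage_measurable [measurable]:
  "(\<lambda>\<omega>. first_passage (\<lambda>j. Z j \<omega>)) \<in> measurable M (count_space UNIV)"
  unfolding first_passage_def by measurable

lemma pred_pos_upto_Z [measurable]: "Measurable.pred M (\<lambda>\<omega>. pos_upto n (\<lambda>j. Z j \<omega>))"
  unfolding pos_upto_def by measurable

text \<open>Borel-Cantelli, the probabilities of \<open>0 < W n\<close> being bounded by powers of
  \<open>rate\<close>.\<close>

lemma AE_eventually_neg: "AE \<omega> in M. eventually (\<lambda>n. W n \<omega> \<le> 0) sequentially"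
proof -
  have geom: "summable (\<lambda>n. rate ^ n)" using rate by (simp add: summable_geometric)
  have "norm (prob {\<omega> \<in> space M. 0 < W n \<omega>}) \<le> rate ^ n" for n
    using prob_pos_le[of n] prob_walk[of "\<lambda>z. 0 < psum z n"] by (simp add: walk.prob_pos_def)
  then have "summable (\<lambda>n. prob {\<omega> \<in> space M. 0 < W n \<omega>})"
    by (rule summable_comparison_test'[OF geom])
  then have "AE \<omega> in M. eventually (\<lambda>n. \<omega> \<in> space M - {\<omega> \<in> space M. 0 < W n \<omega>}) sequentially"
    by (intro borel_cantelli_AE1) (simp_all add: emeasure_eq_measure)
  then show ?thesis
    by eventually_elim (erule eventually_mono, simp add: not_less)
qed

lemma AE_first_passage_exists: "AE \<omega> in M. \<exists>n\<ge>1. W n \<omega> \<le> 0"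
  using AE_eventually_neg
proof eventually_elim
  case (elim \<omega>)
  then obtain N where "\<And>n. N \<le> n \<Longrightarrow> W n \<omega> \<le> 0" by (auto simp: eventually_sequentially)
  then show ?case by (intro exI[of _ "max 1 N"]) auto
qed

lemma prob_less_first_passage:
  "prob {\<omega> \<in> space M. n < first_passage (\<lambda>j. Z j \<omega>)} = prob {\<omega> \<in> space M. pos_upto n (\<lambda>j. Z j \<omega>)}"
proof -
  have "AE \<omega> in M. n < first_passage (\<lambda>j. Z j \<omega>) \<longleftrightarrow> pos_upto n (\<lambda>j. Z j \<omega>)"
    using AE_first_passage_exists by eventually_elim (rule less_first_passage_iff)
  then show ?thesis by (intro measure_eq_AE) auto
qed

text \<open>The expectation of a natural number is the sum of its tail probabilities, evaluated by
  the Sparre Andersen identity.\<close>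

lemma first_passage_expectation:
  "integrable M (\<lambda>\<omega>. real (first_passage (\<lambda>j. Z j \<omega>)))"
  "expectation (\<lambda>\<omega>. real (first_passage (\<lambda>j. Z j \<omega>))) = greedyC (d / s)"
proof -
  have "(\<integral>\<^sup>+\<omega>. ennreal (real (first_passage (\<lambda>j. Z j \<omega>))) \<partial>M)
      = (\<Sum>n. ennreal (prob {\<omega> \<in> space M. pos_upto n (\<lambda>j. Z j \<omega>)}))"
    unfolding ennreal_of_nat_eq_real_of_nat[symmetric]
    by (subst nn_integral_nat_function) (simp_all add: emeasure_eq_measure prob_less_first_passage)
  also have "\<dots> = ennreal (\<Sum>n. prob {\<omega> \<in> space M. pos_upto n (\<lambda>j. Z j \<omega>)})"
    using walk.summable_prob_pos_upto[OF prob_pos_le order_refl rate]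
    by (intro suminf_ennreal2) (simp, simp only: prob_pos_upto_eq)
  finally have "(\<integral>\<^sup>+\<omega>. ennreal (real (first_passage (\<lambda>j. Z j \<omega>))) \<partial>M) = ennreal (greedyC (d / s))"
    by (simp add: suminf_prob_pos_upto)
  then have "integrable M (\<lambda>\<omega>. real (first_passage (\<lambda>j. Z j \<omega>))) \<and>
      expectation (\<lambda>\<omega>. real (first_passage (\<lambda>j. Z j \<omega>))) = greedyC (d / s)"
    by (subst nn_integral_eq_integrable[symmetric]) (auto intro: less_imp_le[OF greedyC_pos])
  then show "integrable M (\<lambda>\<omega>. real (first_passage (\<lambda>j. Z j \<omega>)))"
    "expectation (\<lambda>\<omega>. real (first_passage (\<lambda>j. Z j \<omega>))) = greedyC (d / s)"
    by auto
qed

text \<open>A square is the sum of the first odd numbers, so the second moment is a weighted sum of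
  tail probabilities. Bounding \<open>2 * n + 1\<close> by \<open>2 * Suc n\<close> and the tails by
  \<open>rate ^ n\<close> leaves a differentiated geometric series.\<close>

lemma first_passage_square_expectation:
  "integrable M (\<lambda>\<omega>. (real (first_passage (\<lambda>j. Z j \<omega>)))\<^sup>2)"
  "expectation (\<lambda>\<omega>. (real (first_passage (\<lambda>j. Z j \<omega>)))\<^sup>2) \<le> 2 / (1 - rate)\<^sup>2"
proof -
  let ?T = "\<lambda>\<omega>. first_passage (\<lambda>j. Z j \<omega>)"
  have sq: "ennreal (norm ((real (?T \<omega>))\<^sup>2)) = (\<Sum>n. ennreal (2 * real n + 1) * indicator {\<omega> \<in> space M. n < ?T \<omega>} \<omega>)"
    if "\<omega> \<in> space M" for \<omega>
  proof -
    have odd: "(\<Sum>n<k. 2 * real n + 1) = (real k)\<^sup>2" for k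
      by (induction k) (auto simp: power2_eq_square algebra_simps)
    have "(\<Sum>n. ennreal (2 * real n + 1) * indicator {\<omega> \<in> space M. n < ?T \<omega>} \<omega>)
        = (\<Sum>n<?T \<omega>. ennreal (2 * real n + 1) * indicator {\<omega> \<in> space M. n < ?T \<omega>} \<omega>)"
      by (rule suminf_finite) auto
    also have "\<dots> = (\<Sum>n<?T \<omega>. ennreal (2 * real n + 1))"
      using that by (intro sum.cong) auto
    also have "\<dots> = ennreal ((real (?T \<omega>))\<^sup>2)"
      by (subst sum_ennreal) (simp, simp only: odd)
    finally show ?thesis by simp
  qed
  have sums: "(\<lambda>n. 2 * (real (Suc n) * rate ^ n)) sums (2 * (1 / (1 - rate)\<^sup>2))"
    using geometric_deriv_sums[of rate] rate by (intro sums_mult) simp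
  have "(\<integral>\<^sup>+\<omega>. ennreal (norm ((real (?T \<omega>))\<^sup>2)) \<partial>M)
      = (\<integral>\<^sup>+\<omega>. (\<Sum>n. ennreal (2 * real n + 1) * indicator {\<omega> \<in> space M. n < ?T \<omega>} \<omega>) \<partial>M)"
    by (intro nn_integral_cong sq)
  also have "\<dots> = (\<Sum>n. \<integral>\<^sup>+\<omega>. ennreal (2 * real n + 1) * indicator {\<omega> \<in> space M. n < ?T \<omega>} \<omega> \<partial>M)"
    by (intro nn_integral_suminf) measurable
  also have "\<dots> = (\<Sum>n. ennreal ((2 * real n + 1) * prob {\<omega> \<in> space M. pos_upto n (\<lambda>j. Z j \<omega>)}))"
    by (intro suminf_cong, subst nn_integral_cmult_indicator)
      (auto simp: emeasure_eq_measure prob_less_first_passage ennreal_mult)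
  also have "\<dots> \<le> (\<Sum>n. ennreal (2 * (real (Suc n) * rate ^ n)))"
  proof (intro suminf_le ennreal_leI)
    fix n
    have "(2 * real n + 1) * prob {\<omega> \<in> space M. pos_upto n (\<lambda>j. Z j \<omega>)} \<le> (2 * real (Suc n)) * rate ^ n"
      using prob_pos_upto_le_rate by (intro mult_mono) auto
    then show "(2 * real n + 1) * prob {\<omega> \<in> space M. pos_upto n (\<lambda>j. Z j \<omega>)} \<le> 2 * (real (Suc n) * rate ^ n)"
      by (simp only: mult.assoc)
  qed auto
  also have "\<dots> = ennreal (\<Sum>n. 2 * (real (Suc n) * rate ^ n))"
    using rate by (intro suminf_ennreal2 sums_summable[OF sums]) auto
  finally have bound: "(\<integral>\<^sup>+\<omega>. ennreal (norm ((real (?T \<omega>))\<^sup>2)) \<partial>M) \<le> ennreal (2 / (1 - rate)\<^sup>2)"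
    using sums_unique[OF sums] by simp
  show int: "integrable M (\<lambda>\<omega>. (real (?T \<omega>))\<^sup>2)"
    by (rule integrableI_bounded) (measurable, rule le_less_trans[OF bound], simp)
  have "ennreal (expectation (\<lambda>\<omega>. (real (?T \<omega>))\<^sup>2)) \<le> ennreal (2 / (1 - rate)\<^sup>2)"
    using nn_integral_eq_integral[OF int] bound by simp
  then show "expectation (\<lambda>\<omega>. (real (?T \<omega>))\<^sup>2) \<le> 2 / (1 - rate)\<^sup>2"
    using rate by (subst (asm) ennreal_le_iff) auto
qed

end

section \<open>A weak law of large numbers\<close>

lemma (in prob_space) variance_sum_indep:
  fixes Y :: "'i \<Rightarrow> 'a \<Rightarrow> real"
  assumes "finite I" "indep_vars (\<lambda>_. borel) Y I"
    and "\<And>i. i \<in> I \<Longrightarrow> integrable M (\<lambda>\<omega>. (Y i \<omega>)\<^sup>2)"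
    and "\<And>i. i \<in> I \<Longrightarrow> integrable M (Y i)" "\<And>i. i \<in> I \<Longrightarrow> expectation (Y i) = 0"
  shows "integrable M (\<lambda>\<omega>. (\<Sum>i\<in>I. Y i \<omega>)\<^sup>2) \<and>
    expectation (\<lambda>\<omega>. (\<Sum>i\<in>I. Y i \<omega>)\<^sup>2) = (\<Sum>i\<in>I. expectation (\<lambda>\<omega>. (Y i \<omega>)\<^sup>2))"
  using assms
proof (induction I rule: finite_induct)
  case (insert i I)
  have IH: "integrable M (\<lambda>\<omega>. (\<Sum>i\<in>I. Y i \<omega>)\<^sup>2)"
    "expectation (\<lambda>\<omega>. (\<Sum>i\<in>I. Y i \<omega>)\<^sup>2) = (\<Sum>i\<in>I. expectation (\<lambda>\<omega>. (Y i \<omega>)\<^sup>2))"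
    using insert by (auto intro: indep_vars_subset)
  have ind: "indep_var borel (Y i) borel (\<lambda>\<omega>. \<Sum>i\<in>I. Y i \<omega>)"
    using insert by (intro indep_vars_sum) auto
  have int: "integrable M (Y i)" "integrable M (\<lambda>\<omega>. \<Sum>i\<in>I. Y i \<omega>)"
    using insert.prems by auto
  have cross: "integrable M (\<lambda>\<omega>. Y i \<omega> * (\<Sum>i\<in>I. Y i \<omega>))"
    by (rule indep_var_integrable[OF ind int])
  have cross0: "expectation (\<lambda>\<omega>. Y i \<omega> * (\<Sum>i\<in>I. Y i \<omega>)) = 0"
    using indep_var_lebesgue_integral[OF ind int] insert.prems by simp
  have eq: "(\<lambda>\<omega>. (\<Sum>i\<in>insert i I. Y i \<omega>)\<^sup>2) =
      (\<lambda>\<omega>. (Y i \<omega>)\<^sup>2 + (\<Sum>i\<in>I. Y i \<omega>)\<^sup>2 + 2 * (Y i \<omega> * (\<Sum>i\<in>I. Y i \<omega>)))"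
    using insert by (simp add: power2_sum mult.assoc)
  show ?case
    unfolding eq using insert IH cross cross0 by simp
qed simp

text \<open>Chebyshev's inequality, with each variance bounded by the second moment. An explicit
  bound for finite \<open>I\<close> is what is needed, because the index set grows with the number
  of alternatives.\<close>

lemma (in prob_space) weak_law_bound:
  fixes Y :: "'i \<Rightarrow> 'a \<Rightarrow> real"
  assumes "finite I" and indep: "indep_vars (\<lambda>_. borel) Y I"
    and sq: "\<And>i. i \<in> I \<Longrightarrow> integrable M (\<lambda>\<omega>. (Y i \<omega>)\<^sup>2)"
    and mean: "\<And>i. i \<in> I \<Longrightarrow> expectation (Y i) = m"
    and var: "\<And>i. i \<in> I \<Longrightarrow> expectation (\<lambda>\<omega>. (Y i \<omega>)\<^sup>2) \<le> v"
    and "0 < a"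
  shows "prob {\<omega> \<in> space M. a \<le> \<bar>(\<Sum>i\<in>I. Y i \<omega>) - real (card I) * m\<bar>} \<le> real (card I) * v / a\<^sup>2"
proof -
  have meas: "Y i \<in> borel_measurable M" if "i \<in> I" for i
    using indep that by (auto simp: indep_vars_def)
  have int: "integrable M (Y i)" if "i \<in> I" for i
    using square_integrable_imp_integrable[OF meas sq] that by auto
  have "indep_vars (\<lambda>_. borel) (\<lambda>i \<omega>. Y i \<omega> - m) I"
    by (rule indep_vars_compose2[OF indep, where Y = "\<lambda>_ y. y - m"]) simp
  moreover have "integrable M (\<lambda>\<omega>. (Y i \<omega> - m)\<^sup>2)" if "i \<in> I" for i
    using sq[OF that] int[OF that] by (simp add: power2_diff)
  moreover have "expectation (\<lambda>\<omega>. Y i \<omega> - m) = 0" if "i \<in> I" for i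
    using int[OF that] mean[OF that] by (simp add: prob_space)
  ultimately have V: "integrable M (\<lambda>\<omega>. (\<Sum>i\<in>I. Y i \<omega> - m)\<^sup>2)"
    "expectation (\<lambda>\<omega>. (\<Sum>i\<in>I. Y i \<omega> - m)\<^sup>2) = (\<Sum>i\<in>I. variance (Y i))"
    using variance_sum_indep[of I "\<lambda>i \<omega>. Y i \<omega> - m"] assms(1) int mean by auto
  have "variance (Y i) \<le> v" if "i \<in> I" for i
    using variance_eq[OF int[OF that] sq[OF that]] var[OF that] zero_le_power2[of "expectation (Y i)"]
    by linarith
  then have le: "expectation (\<lambda>\<omega>. (\<Sum>i\<in>I. Y i \<omega> - m)\<^sup>2) \<le> real (card I) * v"
    using V(2) sum_bounded_above[of I "\<lambda>i. variance (Y i)" v] by simp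
  have E: "expectation (\<lambda>\<omega>. \<Sum>i\<in>I. Y i \<omega> - m) = 0"
    using int mean by (simp add: prob_space)
  have "prob {\<omega> \<in> space M. a \<le> \<bar>(\<Sum>i\<in>I. Y i \<omega> - m) - expectation (\<lambda>\<omega>. \<Sum>i\<in>I. Y i \<omega> - m)\<bar>}
      \<le> variance (\<lambda>\<omega>. \<Sum>i\<in>I. Y i \<omega> - m) / a\<^sup>2"
    using V meas \<open>0 < a\<close> by (intro Chebyshev_inequality) auto
  also have "\<dots> \<le> real (card I) * v / a\<^sup>2"
    unfolding E using le by (simp add: divide_right_mono)
  finally show ?thesis unfolding E by (simp add: sum_subtractf)
qed

section \<open>Sample paths of the greedy procedure\<close>

lemma best_properties:
  assumes "1 \<le> k"
  shows "best xs k cnt < k" "\<And>j. j < k \<Longrightarrow> sample_mean xs j (cnt j) \<le> sample_mean xs (best xs k cnt) (cnt (best xs k cnt))"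
proof -
  let ?f = "\<lambda>i. sample_mean xs i (cnt i)"
  have "Max (?f ` {..<k}) \<in> ?f ` {..<k}"
    using assms by (intro Max_in) (auto simp: lessThan_empty_iff)
  then obtain i where "i < k" "?f i = Max (?f ` {..<k})" by auto
  then have "i < k \<and> (\<forall>j<k. ?f j \<le> ?f i)" by auto
  then have "best xs k cnt < k \<and> (\<forall>j<k. ?f j \<le> ?f (best xs k cnt))"
    unfolding best_def by (rule LeastI)
  then show "best xs k cnt < k" "\<And>j. j < k \<Longrightarrow> ?f j \<le> ?f (best xs k cnt)" by auto
qed

text \<open>Ties go to the smallest index, so being weakly best already means that index 0 is
  chosen.\<close>

lemma best_eq_0_iff:
  assumes "1 \<le> k"
  shows "best xs k cnt = 0 \<longleftrightarrow> (\<forall>j<k. sample_mean xs j (cnt j) \<le> sample_mean xs 0 (cnt 0))"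
proof
  assume "best xs k cnt = 0"
  then show "\<forall>j<k. sample_mean xs j (cnt j) \<le> sample_mean xs 0 (cnt 0)"
    using best_properties(2)[OF assms, of _ xs cnt] by metis
next
  assume "\<forall>j<k. sample_mean xs j (cnt j) \<le> sample_mean xs 0 (cnt 0)"
  then have "best xs k cnt \<le> 0" unfolding best_def using assms by (intro Least_le) simp
  then show "best xs k cnt = 0" by simp
qed

lemma greedy_counts_Suc:
  "greedy_counts xs k (Suc t) i =
    (if i = best xs k (greedy_counts xs k t) then greedy_counts xs k t i + 1 else greedy_counts xs k t i)"
  by (simp add: Let_def)

declare greedy_counts.simps(2) [simp del]

lemma greedy_counts_ge_1: "1 \<le> greedy_counts xs k t i"
  by (induction t) (auto simp: greedy_counts_Suc)

lemma greedy_counts_le_Suc: "greedy_counts xs k t i \<le> greedy_counts xs k (Suc t) i"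
  by (simp add: greedy_counts_Suc)

lemma sum_greedy_counts:
  assumes "1 \<le> k"
  shows "(\<Sum>i<k. greedy_counts xs k t i) = k + t"
proof (induction t)
  case (Suc t)
  let ?b = "best xs k (greedy_counts xs k t)"
  have "(\<Sum>i<k. greedy_counts xs k (Suc t) i) = (\<Sum>i<k. greedy_counts xs k t i + (if i = ?b then 1 else 0))"
    by (intro sum.cong) (auto simp: greedy_counts_Suc)
  also have "\<dots> = (\<Sum>i<k. greedy_counts xs k t i) + 1"
    using best_properties(1)[OF assms] by (simp add: sum.distrib)
  finally show ?case using Suc by simp
qed simp

lemma budget_split:
  assumes "1 \<le> k" "k \<le> B"
  shows "greedy_counts xs k (B - k) 0 + (\<Sum>i\<in>{1..<k}. greedy_counts xs k (B - k) i) = B"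
proof -
  have "{..<k} = insert 0 {1..<k}" using assms by auto
  then show ?thesis using sum_greedy_counts[OF assms(1), of xs "B - k"] assms by simp
qed

text \<open>While index 0 has shown only means above \<open>b\<close>, choosing \<open>i\<close>
  requires a current mean above \<open>b\<close>. Hence \<open>i\<close> is never chosen while
  holding exactly \<open>N\<close> observations, and its count cannot pass \<open>N\<close>.\<close>

lemma greedy_counts_le_passage:
  assumes "1 \<le> k" "1 \<le> i" "i < k" "1 \<le> N" "sample_mean xs i N \<le> b"
    and "\<And>n. 1 \<le> n \<Longrightarrow> n \<le> greedy_counts xs k t 0 \<Longrightarrow> b < sample_mean xs 0 n"
  shows "greedy_counts xs k t i \<le> N"
  using assms(6)
proof (induction t)
  case 0
  then show ?case using \<open>1 \<le> N\<close> by simp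
next
  case (Suc t)
  let ?c = "greedy_counts xs k t"
  have above: "b < sample_mean xs 0 n" if "1 \<le> n" "n \<le> ?c 0" for n
    using Suc.prems that greedy_counts_le_Suc[of xs k t 0] by (meson order_trans)
  have IH: "?c i \<le> N" using Suc.IH above by blast
  show ?case
  proof (cases "i = best xs k ?c")
    case True
    have "b < sample_mean xs i (?c i)"
      using above[of "?c 0"] best_properties(2)[OF assms(1), of 0 xs ?c] greedy_counts_ge_1[of xs k t 0] assms(1) True
      by fastforce
    then have "?c i \<noteq> N" using assms(5) by auto
    then show ?thesis using IH True by (simp add: greedy_counts_Suc)
  qed (use IH in \<open>simp add: greedy_counts_Suc\<close>)
qed

text \<open>Index 0 received its observation number \<open>n + 1\<close> because it was best when
  holding \<open>n\<close>. At that moment every other current mean was at most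
  \<open>sample_mean xs 0 n\<close>, and counts never decrease.\<close>

lemma passage_le_greedy_counts:
  assumes "1 \<le> k" "1 \<le> n" "n < greedy_counts xs k t 0" "i < k"
  shows "\<exists>N\<ge>1. N \<le> greedy_counts xs k t i \<and> sample_mean xs i N \<le> sample_mean xs 0 n"
  using assms(2-)
proof (induction t)
  case (Suc t)
  let ?c = "greedy_counts xs k t"
  show ?case
  proof (cases "n < ?c 0")
    case True
    then show ?thesis using Suc greedy_counts_le_Suc[of xs k t i] by (meson order_trans)
  next
    case False
    then have "best xs k ?c = 0" "n = ?c 0"
      using Suc.prems(2) by (auto simp: greedy_counts_Suc split: if_splits)
    then have "sample_mean xs i (?c i) \<le> sample_mean xs 0 n"
      using best_eq_0_iff[OF assms(1), of xs ?c] Suc.prems(3) by simp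
    then show ?thesis using greedy_counts_ge_1 greedy_counts_le_Suc by blast
  qed
qed simp

text \<open>When index 0 is chosen while holding \<open>J\<close> observations, all other means lie
  at or below its overall minimum. From then on its own mean is never smaller, so it is best at
  every step and the other means stay frozen.\<close>

lemma best_locked_after_minimum:
  assumes "1 \<le> k" "1 \<le> J" "\<And>n. 1 \<le> n \<Longrightarrow> sample_mean xs 0 J \<le> sample_mean xs 0 n"
    and "J < greedy_counts xs k t 0"
  shows "best xs k (greedy_counts xs k t) = 0"
proof -
  have "\<forall>i. 1 \<le> i \<longrightarrow> i < k \<longrightarrow> sample_mean xs i (greedy_counts xs k t i) \<le> sample_mean xs 0 J"
    using assms(4)
  proof (induction t)
    case (Suc t)
    let ?c = "greedy_counts xs k t"
    have le: "sample_mean xs i (?c i) \<le> sample_mean xs 0 J" if "1 \<le> i" "i < k" for i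
    proof (cases "J < ?c 0")
      case True
      then show ?thesis using Suc.IH that by blast
    next
      case False
      then have "best xs k ?c = 0" "J = ?c 0"
        using Suc.prems by (auto simp: greedy_counts_Suc split: if_splits)
      then show ?thesis using best_eq_0_iff[OF assms(1), of xs ?c] that by simp
    qed
    have "best xs k ?c = 0"
      unfolding best_eq_0_iff[OF assms(1)]
    proof safe
      fix j assume "j < k"
      then show "sample_mean xs j (?c j) \<le> sample_mean xs 0 (?c 0)"
        using le[of j] assms(3)[of "?c 0"] greedy_counts_ge_1[of xs k t 0] by (cases "j = 0") auto
    qed
    then show ?case using le by (auto simp: greedy_counts_Suc)
  qed (use assms(2) in simp)
  then show ?thesis
    unfolding best_eq_0_iff[OF assms(1)]
    using assms(3)[OF greedy_counts_ge_1] by (metis less_one not_le order_refl order_trans)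
qed

text \<open>The other alternatives use at most the sum of the \<open>N i\<close>, so the budget
  pushes index 0 beyond its minimum, after which it is locked in.\<close>

lemma greedy_select_correct:
  assumes "1 \<le> k" "k \<le> B" "1 \<le> J" "\<And>n. 1 \<le> n \<Longrightarrow> sample_mean xs 0 J \<le> sample_mean xs 0 n"
    and "\<And>n. 1 \<le> n \<Longrightarrow> b < sample_mean xs 0 n"
    and "\<And>i. 1 \<le> i \<Longrightarrow> i < k \<Longrightarrow> 1 \<le> N i \<and> sample_mean xs i (N i) \<le> b"
    and "J + (\<Sum>i\<in>{1..<k}. N i) < B"
  shows "greedy_select xs k B = 0"
proof -
  let ?c = "greedy_counts xs k (B - k)"
  have "(\<Sum>i\<in>{1..<k}. ?c i) \<le> (\<Sum>i\<in>{1..<k}. N i)"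
    using assms by (intro sum_mono greedy_counts_le_passage[where b = b]) auto
  then have "J < ?c 0" using budget_split[OF assms(1,2), of xs] assms(7) by linarith
  then show ?thesis
    unfolding greedy_select_def using best_locked_after_minimum assms(1,3,4) by blast
qed

text \<open>If index 0 shows a mean below \<open>a\<close> and still wins, every other alternative
  has been at or below \<open>a\<close> and has cost at least \<open>L i\<close>. Otherwise all its
  observed means exceed \<open>b\<close>: it has not passed \<open>J\<close>, and the others have
  not passed \<open>N i\<close>.\<close>

lemma greedy_select_correct_bounds:
  assumes "1 \<le> k" "k \<le> B" "greedy_select xs k B = 0"
    and "1 \<le> J" "sample_mean xs 0 J < a"
    and "\<And>n. 1 \<le> n \<Longrightarrow> sample_mean xs 0 n < a \<or> b < sample_mean xs 0 n"
    and "\<And>i. 1 \<le> i \<Longrightarrow> i < k \<Longrightarrow> 1 \<le> N i \<and> sample_mean xs i (N i) \<le> b"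
    and "\<And>i n. 1 \<le> i \<Longrightarrow> i < k \<Longrightarrow> 1 \<le> n \<Longrightarrow> sample_mean xs i n \<le> a \<Longrightarrow> L i \<le> n"
  shows "(\<Sum>i\<in>{1..<k}. L i) \<le> B \<or> B \<le> J + (\<Sum>i\<in>{1..<k}. N i)"
proof -
  let ?c = "greedy_counts xs k (B - k)"
  have best: "best xs k ?c = 0" using assms(3) by (simp add: greedy_select_def)
  show ?thesis
  proof (cases "\<exists>n. 1 \<le> n \<and> n \<le> ?c 0 \<and> sample_mean xs 0 n < a")
    case True
    then obtain n where n: "1 \<le> n" "n \<le> ?c 0" "sample_mean xs 0 n < a" by blast
    have "L i \<le> ?c i" if i: "1 \<le> i" "i < k" for i
    proof -
      have "\<exists>N\<ge>1. N \<le> ?c i \<and> sample_mean xs i N \<le> sample_mean xs 0 n"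
      \<comment> \<open>If \<open>n\<close> is the final count, the final selection itself provides
        the comparison of means.\<close>
      proof (cases "n < ?c 0")
        case True
        then show ?thesis using passage_le_greedy_counts[OF assms(1) n(1) _ i(2)] by blast
      next
        case False
        then have "sample_mean xs i (?c i) \<le> sample_mean xs 0 n"
          using best_eq_0_iff[OF assms(1), of xs ?c] best i n by simp
        then show ?thesis using greedy_counts_ge_1 by blast
      qed
      then obtain N where "1 \<le> N" "N \<le> ?c i" "sample_mean xs i N \<le> sample_mean xs 0 n" by blast
      then show ?thesis using assms(8)[OF i, of N] n(3) by linarith
    qed
    then have "(\<Sum>i\<in>{1..<k}. L i) \<le> (\<Sum>i\<in>{1..<k}. ?c i)" by (intro sum_mono) auto
    then show ?thesis using budget_split[OF assms(1,2), of xs] by linarith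
  next
    case False
    then have above: "b < sample_mean xs 0 n" if "1 \<le> n" "n \<le> ?c 0" for n
      using assms(6) that by blast
    have "?c 0 \<le> J" using False assms(4,5) by (meson nat_le_linear)
    moreover have "(\<Sum>i\<in>{1..<k}. ?c i) \<le> (\<Sum>i\<in>{1..<k}. N i)"
      using assms(1,7) above by (intro sum_mono greedy_counts_le_passage[where b = b]) auto
    ultimately show ?thesis using budget_split[OF assms(1,2), of xs] by linarith
  qed
qed

section \<open>Measurability of the selection\<close>

context
  fixes M :: "'a measure" and X :: "nat \<Rightarrow> nat \<Rightarrow> 'a \<Rightarrow> real"
  assumes X [measurable]: "\<And>i j. X i j \<in> borel_measurable M"
begin

lemma sample_mean_measurable [measurable]:
  "(\<lambda>\<omega>. sample_mean (\<lambda>i j. X i j \<omega>) i n) \<in> borel_measurable M"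
  unfolding sample_mean_def by measurable

lemma best_measurable [measurable]:
  "(\<lambda>\<omega>. best (\<lambda>i j. X i j \<omega>) k f) \<in> measurable M (count_space UNIV)"
  unfolding best_def by measurable

text \<open>The counts are random functions, so \<open>Q\<close> stays arbitrary in the induction:
  \<open>R f\<close> absorbs the last step for a deterministic \<open>f\<close>, where the chosen
  index ranges over a countable set.\<close>

lemma pred_greedy_counts:
  assumes "\<And>f. Measurable.pred M (Q f)"
  shows "Measurable.pred M (\<lambda>\<omega>. Q (greedy_counts (\<lambda>i j. X i j \<omega>) k t) \<omega>)"
  using assms
proof (induction t arbitrary: Q)
  case (Suc t)
  have [measurable]: "Measurable.pred M (Q f)" for f by (rule Suc.prems)
  define R where "R f \<omega> \<longleftrightarrow> (\<exists>i. i = best (\<lambda>i j. X i j \<omega>) k f \<and> Q (f(i := f i + 1)) \<omega>)" for f \<omega>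
  have "Measurable.pred M (R f)" for f
    unfolding R_def by measurable
  then have "Measurable.pred M (\<lambda>\<omega>. R (greedy_counts (\<lambda>i j. X i j \<omega>) k t) \<omega>)"
    by (rule Suc.IH)
  then show ?case
    by (simp add: R_def greedy_counts.simps(2) Let_def fun_upd_def)
qed simp

lemma greedy_select_measurable [measurable]:
  "Measurable.pred M (\<lambda>\<omega>. greedy_select (\<lambda>i j. X i j \<omega>) k B = i)"
  unfolding greedy_select_def by (rule pred_greedy_counts) measurable

end

section \<open>First passages of the alternatives\<close>

lemma psum_diff_const: "psum (\<lambda>j. z j - b) n = psum z n - real n * b"
  by (simp add: psum_def sum_subtractf)

lemma psum_const_diff: "psum (\<lambda>j. b - z j) n = real n * b - psum z n"
  by (simp add: psum_def sum_subtractf)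

lemma sample_mean_psum: "sample_mean xs i n = psum (xs i) n / real n"
  by (simp add: sample_mean_def psum_def)

lemma psum_diff_const_le_0_iff: "1 \<le> n \<Longrightarrow> psum (\<lambda>j. xs i j - b) n \<le> 0 \<longleftrightarrow> sample_mean xs i n \<le> b"
  by (simp add: psum_diff_const sample_mean_psum divide_le_eq mult.commute)

lemma psum_const_diff_less_0_iff: "1 \<le> n \<Longrightarrow> psum (\<lambda>j. b - xs i j) n < 0 \<longleftrightarrow> b < sample_mean xs i n"
  by (simp add: psum_const_diff sample_mean_psum less_divide_eq mult.commute)

lemma psum_const_diff_le_0_iff: "1 \<le> n \<Longrightarrow> psum (\<lambda>j. b - xs i j) n \<le> 0 \<longleftrightarrow> b \<le> sample_mean xs i n"
  by (simp add: psum_const_diff sample_mean_psum le_divide_eq mult.commute)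

lemma psum_const_diff_pos_iff: "1 \<le> n \<Longrightarrow> 0 < psum (\<lambda>j. b - xs i j) n \<longleftrightarrow> sample_mean xs i n < b"
  by (simp add: psum_const_diff sample_mean_psum divide_less_eq mult.commute)

text \<open>At \<open>(mu1 - b) / \<sigma>\<close> this is the expected number of times
  \<open>n \<ge> 1\<close> at which the mean of the best alternative is below \<open>b\<close>. The
  factor 1 is the weight in \<open>isCont_Phi_series\<close>.\<close>

definition Phi_sum :: "real \<Rightarrow> real" where
  "Phi_sum x = (\<Sum>m. 1 * Phi (- sqrt (real (Suc m)) * x))"

lemma isCont_Phi_sum: "0 < x \<Longrightarrow> isCont Phi_sum x"
  unfolding Phi_sum_def[abs_def] by (rule isCont_Phi_series) auto

section \<open>The selection model with equal gaps and variances\<close>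

locale selection_model = prob_space +
  fixes X :: "nat \<Rightarrow> nat \<Rightarrow> 'a \<Rightarrow> real" and mu1 \<gamma> \<sigma> :: real
  assumes indep_X: "indep_vars (\<lambda>_. borel) (\<lambda>p. X (fst p) (snd p)) UNIV"
    and distributed_best: "\<And>j. distributed M lborel (X 0 j) (normal_density mu1 \<sigma>)"
    and distributed_other: "\<And>i j. i \<ge> 1 \<Longrightarrow> distributed M lborel (X i j) (normal_density (mu1 - \<gamma>) \<sigma>)"
    and \<sigma>_pos: "0 < \<sigma>"
begin

abbreviation "Xm i n \<omega> \<equiv> sample_mean (\<lambda>i j. X i j \<omega>) i n"

definition passage :: "real \<Rightarrow> nat \<Rightarrow> 'a \<Rightarrow> nat" where
  "passage b i \<omega> = first_passage (\<lambda>j. X i j \<omega> - b)"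

definition total_passage :: "real \<Rightarrow> nat \<Rightarrow> 'a \<Rightarrow> nat" where
  "total_passage b k \<omega> = (\<Sum>i\<in>{1..<k}. passage b i \<omega>)"

lemma X_measurable [measurable]: "X i j \<in> borel_measurable M"
  using indep_X unfolding indep_vars_def by force

lemma indep_row: "indep_vars (\<lambda>_. borel) (X i) UNIV"
proof -
  have "indep_vars (\<lambda>j. PiM {(i, j)} (\<lambda>_. borel)) (\<lambda>j \<omega>. restrict (\<lambda>p. X (fst p) (snd p) \<omega>) {(i, j)}) UNIV"
    by (rule indep_vars_restrict[OF indep_X]) (auto simp: disjoint_family_on_def)
  then have "indep_vars (\<lambda>_. borel) (\<lambda>j \<omega>. (restrict (\<lambda>p. X (fst p) (snd p) \<omega>) {(i, j)}) (i, j)) UNIV"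
    by (rule indep_vars_compose2) (rule measurable_component_singleton, simp)
  then show ?thesis by simp
qed

text \<open>Each passage time is a measurable function of one row of the array of observations, and
  the rows are disjoint blocks of independent variables.\<close>

lemma indep_passage: "indep_vars (\<lambda>_. borel) (\<lambda>i \<omega>. real (passage b i \<omega>)) UNIV"
proof -
  have "indep_vars (\<lambda>i. PiM (range (Pair i)) (\<lambda>_. borel))
      (\<lambda>i \<omega>. restrict (\<lambda>p. X (fst p) (snd p) \<omega>) (range (Pair i))) UNIV"
    by (rule indep_vars_restrict[OF indep_X]) (auto simp: disjoint_family_on_def)
  then have "indep_vars (\<lambda>_. borel)
      (\<lambda>i \<omega>. real (first_passage (\<lambda>j. (restrict (\<lambda>p. X (fst p) (snd p) \<omega>) (range (Pair i))) (i, j) - b))) UNIV"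
  proof (rule indep_vars_compose2[where Y = "\<lambda>i f. real (first_passage (\<lambda>j. f (i, j) - b))"])
    fix i
    have "(\<lambda>f. f (i, j)) \<in> borel_measurable (PiM (range (Pair i)) (\<lambda>_. borel :: real measure))" for j
      by (rule measurable_component_singleton) simp
    then have [measurable]: "(\<lambda>f. psum (\<lambda>j. f (i, j) - b) n) \<in> borel_measurable (PiM (range (Pair i)) (\<lambda>_. borel))" for n
      unfolding psum_def by (intro borel_measurable_sum borel_measurable_diff borel_measurable_const)
    have "(\<lambda>f. first_passage (\<lambda>j. f (i, j) - b)) \<in> measurable (PiM (range (Pair i)) (\<lambda>_. borel)) (count_space UNIV)"
      unfolding first_passage_def by measurable
    then show "(\<lambda>f. real (first_passage (\<lambda>j. f (i, j) - b))) \<in> borel_measurable (PiM (range (Pair i)) (\<lambda>_. borel))"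
      by (rule measurable_compose) simp
  qed
  then show ?thesis by (simp add: passage_def)
qed

lemma other_walk:
  assumes "1 \<le> i" "mu1 - \<gamma> < b"
  shows "gaussian_walk M (\<lambda>j \<omega>. X i j \<omega> - b) (b - (mu1 - \<gamma>)) \<sigma>"
proof unfold_locales
  show "indep_vars (\<lambda>_. borel) (\<lambda>j \<omega>. X i j \<omega> - b) UNIV"
    by (rule indep_vars_compose2[OF indep_row, where Y = "\<lambda>_ x. x - b"]) simp
  show "distributed M lborel (\<lambda>\<omega>. X i j \<omega> - b) (normal_density (- (b - (mu1 - \<gamma>))) \<sigma>)" for j
    using normal_density_affine[OF distributed_other[OF assms(1)] \<sigma>_pos, of 1 "- b"] by simp
qed (use assms \<sigma>_pos in auto)

text \<open>The sign is reversed, so that the best alternative staying above a level below its mean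
  again becomes a walk of negative drift that stays negative.\<close>

lemma best_walk:
  assumes "b < mu1"
  shows "gaussian_walk M (\<lambda>j \<omega>. b - X 0 j \<omega>) (mu1 - b) \<sigma>"
proof unfold_locales
  show "indep_vars (\<lambda>_. borel) (\<lambda>j \<omega>. b - X 0 j \<omega>) UNIV"
    by (rule indep_vars_compose2[OF indep_row, where Y = "\<lambda>_ x. b - x"]) simp
  show "distributed M lborel (\<lambda>\<omega>. b - X 0 j \<omega>) (normal_density (- (mu1 - b)) \<sigma>)" for j
    using normal_density_affine[OF distributed_best \<sigma>_pos, of "- 1" b] by simp
qed (use assms \<sigma>_pos in auto)

lemma prob_best_above:
  assumes "b < mu1"
  shows "prob {\<omega> \<in> space M. \<forall>n\<ge>1. b < Xm 0 n \<omega>} = 1 / greedyC ((mu1 - b) / \<sigma>)"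
proof -
  interpret w: gaussian_walk M "\<lambda>j \<omega>. b - X 0 j \<omega>" "mu1 - b" \<sigma> by (rule best_walk[OF assms])
  have "(\<forall>n\<ge>1. w.W n \<omega> < 0) \<longleftrightarrow> (\<forall>n\<ge>1. b < Xm 0 n \<omega>)" for \<omega>
    using psum_const_diff_less_0_iff[of _ b "\<lambda>i j. X i j \<omega>" 0] by blast
  then show ?thesis using w.prob_always_neg by simp
qed

lemma prob_best_at_least:
  assumes "b < mu1"
  shows "prob {\<omega> \<in> space M. \<forall>n\<ge>1. b \<le> Xm 0 n \<omega>} = 1 / greedyC ((mu1 - b) / \<sigma>)"
proof -
  interpret w: gaussian_walk M "\<lambda>j \<omega>. b - X 0 j \<omega>" "mu1 - b" \<sigma> by (rule best_walk[OF assms])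
  have "(\<forall>n. psum (\<lambda>j. b - X 0 j \<omega>) n \<le> 0) \<longleftrightarrow> (\<forall>n\<ge>1. b \<le> Xm 0 n \<omega>)" for \<omega>
    using psum_const_diff_le_0_iff[of _ b "\<lambda>i j. X i j \<omega>" 0] by (metis less_one not_le order_refl psum_0)
  then show ?thesis using w.prob_never_pos by simp
qed

lemma prob_best_below:
  assumes "b < mu1"
  shows "prob {\<omega> \<in> space M. Xm 0 (Suc n) \<omega> < b} = Phi (- sqrt (real (Suc n)) * ((mu1 - b) / \<sigma>))"
proof -
  interpret w: gaussian_walk M "\<lambda>j \<omega>. b - X 0 j \<omega>" "mu1 - b" \<sigma> by (rule best_walk[OF assms])
  have "0 < w.W (Suc n) \<omega> \<longleftrightarrow> Xm 0 (Suc n) \<omega> < b" for \<omega>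
    using psum_const_diff_pos_iff[of "Suc n" b "\<lambda>i j. X i j \<omega>" 0] by simp
  then show ?thesis using w.prob_W_pos[of "Suc n"] by simp
qed

text \<open>Union bound over \<open>n\<close>, each term being a difference of two normal tails. By
  continuity of \<open>Phi_sum\<close> the bound vanishes as the band shrinks.\<close>

lemma prob_best_touches:
  assumes "a \<le> b" "b < mu1"
  shows "prob {\<omega> \<in> space M. \<exists>n\<ge>1. a \<le> Xm 0 n \<omega> \<and> Xm 0 n \<omega> < b} \<le> Phi_sum ((mu1 - b) / \<sigma>) - Phi_sum ((mu1 - a) / \<sigma>)"
proof -
  define E where "E n = {\<omega> \<in> space M. a \<le> Xm 0 (Suc n) \<omega> \<and> Xm 0 (Suc n) \<omega> < b}" for n
  have [measurable]: "E n \<in> sets M" for n unfolding E_def by measurable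
  have prob_E: "prob (E n) = 1 * Phi (- sqrt (real (Suc n)) * ((mu1 - b) / \<sigma>)) - 1 * Phi (- sqrt (real (Suc n)) * ((mu1 - a) / \<sigma>))" for n
  proof -
    have "E n = {\<omega> \<in> space M. Xm 0 (Suc n) \<omega> < b} - {\<omega> \<in> space M. Xm 0 (Suc n) \<omega> < a}"
      by (auto simp: E_def)
    moreover have "prob ({\<omega> \<in> space M. Xm 0 (Suc n) \<omega> < b} - {\<omega> \<in> space M. Xm 0 (Suc n) \<omega> < a})
        = prob {\<omega> \<in> space M. Xm 0 (Suc n) \<omega> < b} - prob {\<omega> \<in> space M. Xm 0 (Suc n) \<omega> < a}"
      using assms(1) by (intro finite_measure_Diff) auto
    ultimately show ?thesis using prob_best_below[of b n] prob_best_below[of a n] assms by simp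
  qed
  have summable: "summable (\<lambda>n. 1 * Phi (- sqrt (real (Suc n)) * ((mu1 - x) / \<sigma>)))" if "x < mu1" for x
    using that \<sigma>_pos by (intro summable_Phi_series) auto
  have sum_E: "summable (\<lambda>n. prob (E n))"
    unfolding prob_E using assms by (intro summable_diff summable) auto
  have "{\<omega> \<in> space M. \<exists>n\<ge>1. a \<le> Xm 0 n \<omega> \<and> Xm 0 n \<omega> < b} \<subseteq> (\<Union>n. E n)"
  proof
    fix \<omega> assume "\<omega> \<in> {\<omega> \<in> space M. \<exists>n\<ge>1. a \<le> Xm 0 n \<omega> \<and> Xm 0 n \<omega> < b}"
    then obtain n where "\<omega> \<in> space M" "1 \<le> n" "a \<le> Xm 0 n \<omega>" "Xm 0 n \<omega> < b" by blast
    then have "\<omega> \<in> E (n - 1)" by (simp add: E_def)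
    then show "\<omega> \<in> (\<Union>n. E n)" by blast
  qed
  then have "prob {\<omega> \<in> space M. \<exists>n\<ge>1. a \<le> Xm 0 n \<omega> \<and> Xm 0 n \<omega> < b} \<le> prob (\<Union>n. E n)"
    by (rule finite_measure_mono) simp
  also have "\<dots> \<le> (\<Sum>n. prob (E n))"
    by (rule finite_measure_subadditive_countably[OF _ sum_E]) auto
  also have "\<dots> = Phi_sum ((mu1 - b) / \<sigma>) - Phi_sum ((mu1 - a) / \<sigma>)"
    unfolding prob_E Phi_sum_def using assms by (intro suminf_diff[symmetric] summable) auto
  finally show ?thesis .
qed

text \<open>Staying at or above \<open>mu1\<close> forces staying above
  \<open>mu1 - x * \<sigma>\<close> for every \<open>x > 0\<close>. That has probability
  \<open>1 / greedyC x\<close>, which is arbitrarily small because \<open>greedyC\<close> is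
  unbounded near 0.\<close>

lemma AE_best_below_mean: "AE \<omega> in M. \<exists>n\<ge>1. Xm 0 n \<omega> < mu1"
proof -
  let ?E = "{\<omega> \<in> space M. \<forall>n\<ge>1. mu1 \<le> Xm 0 n \<omega>}"
  have "prob ?E \<le> 0 + e" if "0 < e" for e
  proof -
    obtain x where x: "0 < x" "1 / e < greedyC x" using greedyC_unbounded[of 1 "1 / e"] by auto
    have "prob ?E \<le> prob {\<omega> \<in> space M. \<forall>n\<ge>1. mu1 - x * \<sigma> \<le> Xm 0 n \<omega>}"
    proof (rule finite_measure_mono)
      have "0 < x * \<sigma>" using x \<sigma>_pos by simp
      then show "?E \<subseteq> {\<omega> \<in> space M. \<forall>n\<ge>1. mu1 - x * \<sigma> \<le> Xm 0 n \<omega>}" by fastforce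
    qed measurable
    also have "\<dots> = 1 / greedyC x"
      using prob_best_at_least[of "mu1 - x * \<sigma>"] x \<sigma>_pos by simp
    also have "\<dots> \<le> e"
      using x \<open>0 < e\<close> greedyC_pos[of x] by (simp add: field_simps)
    finally show ?thesis by simp
  qed
  then have "prob ?E \<le> 0" by (rule field_le_epsilon)
  then have "prob ?E = 0" by (simp add: measure_le_0_iff)
  then have "AE \<omega> in M. \<omega> \<notin> ?E"
    by (subst AE_iff_measurable[OF _ refl]) (auto simp: emeasure_eq_measure)
  then show ?thesis by (auto simp: not_le)
qed

text \<open>Some mean lies below \<open>mu1\<close> by a definite amount, while eventually all means
  are closer to \<open>mu1\<close> or above it, so only finitely many times compete. Countably many
  levels keep the exceptional set null.\<close>

lemma AE_best_attains_min: "AE \<omega> in M. \<exists>J\<ge>1. \<forall>n\<ge>1. Xm 0 J \<omega> \<le> Xm 0 n \<omega>"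
proof -
  have "AE \<omega> in M. eventually (\<lambda>n. psum (\<lambda>j. (mu1 - inverse (real (Suc r))) - X 0 j \<omega>) n \<le> 0) sequentially" for r
  proof -
    interpret w: gaussian_walk M "\<lambda>j \<omega>. (mu1 - inverse (real (Suc r))) - X 0 j \<omega>" "mu1 - (mu1 - inverse (real (Suc r)))" \<sigma>
      by (rule best_walk) simp
    show ?thesis by (rule w.AE_eventually_neg)
  qed
  then have "AE \<omega> in M. \<forall>r. eventually (\<lambda>n. psum (\<lambda>j. (mu1 - inverse (real (Suc r))) - X 0 j \<omega>) n \<le> 0) sequentially"
    by (subst AE_all_countable) blast
  then show ?thesis
    using AE_best_below_mean
  proof eventually_elim
    case (elim \<omega>)
    then obtain n0 where n0: "1 \<le> n0" "Xm 0 n0 \<omega> < mu1" by blast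
    obtain r where r: "inverse (real (Suc r)) < mu1 - Xm 0 n0 \<omega>"
      using reals_Archimedean[of "mu1 - Xm 0 n0 \<omega>"] n0 by auto
    obtain N where N: "\<And>n. N \<le> n \<Longrightarrow> psum (\<lambda>j. (mu1 - inverse (real (Suc r))) - X 0 j \<omega>) n \<le> 0"
      using elim(1) unfolding eventually_sequentially by blast
    let ?I = "{1..max N n0}"
    obtain J where J: "J \<in> ?I" "\<And>n. n \<in> ?I \<Longrightarrow> Xm 0 J \<omega> \<le> Xm 0 n \<omega>"
      using arg_min_if_finite[of ?I "\<lambda>n. Xm 0 n \<omega>"] n0 by (metis (no_types, lifting) atLeastAtMost_iff empty_iff finite_atLeastAtMost linorder_not_le max.cobounded2)
    have "Xm 0 J \<omega> \<le> Xm 0 n \<omega>" if "1 \<le> n" for n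
    proof (cases "n \<le> max N n0")
      case True
      then show ?thesis using J that by simp
    next
      case False
      then have "mu1 - inverse (real (Suc r)) \<le> Xm 0 n \<omega>"
        using N[of n] psum_const_diff_le_0_iff[OF that, of _ "\<lambda>i j. X i j \<omega>" 0] by simp
      moreover have "Xm 0 J \<omega> \<le> Xm 0 n0 \<omega>" using J(2)[of n0] n0 by simp
      ultimately show ?thesis using r by linarith
    qed
    then show ?case using J(1) by auto
  qed
qed

lemma AE_passage_exists:
  assumes "mu1 - \<gamma> < b"
  shows "AE \<omega> in M. \<forall>i. 1 \<le> i \<longrightarrow> 1 \<le> passage b i \<omega> \<and> Xm i (passage b i \<omega>) \<omega> \<le> b"
proof (subst AE_all_countable, rule allI)
  fix i :: nat
  show "AE \<omega> in M. 1 \<le> i \<longrightarrow> 1 \<le> passage b i \<omega> \<and> Xm i (passage b i \<omega>) \<omega> \<le> b"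
  proof (cases "1 \<le> i")
    case True
    interpret w: gaussian_walk M "\<lambda>j \<omega>. X i j \<omega> - b" "b - (mu1 - \<gamma>)" \<sigma>
      by (rule other_walk[OF True assms])
    show ?thesis
      using w.AE_first_passage_exists
    proof eventually_elim
      case (elim \<omega>)
      then show ?case
        using first_passage_attained[of "\<lambda>j. X i j \<omega> - b"] psum_diff_const_le_0_iff[of _ "\<lambda>i j. X i j \<omega>" i b]
        unfolding passage_def by blast
    qed
  qed simp
qed

lemma passage_le: "1 \<le> n \<Longrightarrow> Xm i n \<omega> \<le> b \<Longrightarrow> passage b i \<omega> \<le> n"
  unfolding passage_def
  using first_passage_least[of n "\<lambda>j. X i j \<omega> - b"] psum_diff_const_le_0_iff[of n "\<lambda>i j. X i j \<omega>" i b] by blast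

lemma total_passage_measurable [measurable]:
  "(\<lambda>\<omega>. real (total_passage b k \<omega>)) \<in> borel_measurable M"
proof -
  have "(\<lambda>\<omega>. real (passage b i \<omega>)) \<in> borel_measurable M" for i
    using indep_passage[of b] by (auto simp: indep_vars_def)
  then show ?thesis unfolding total_passage_def by simp
qed

text \<open>All passage times share one second-moment bound, so the failure probability is of order
  1/k. There are \<open>k - 1\<close> summands because index 0 is left out.\<close>

lemma total_passage_weak_law:
  assumes "mu1 - \<gamma> < b" "0 < \<eta>"
  shows "(\<lambda>k. prob {\<omega> \<in> space M. \<eta> * real k \<le>
    \<bar>real (total_passage b k \<omega>) - real (k - 1) * greedyC ((b - (mu1 - \<gamma>)) / \<sigma>)\<bar>}) \<longlonglongrightarrow> 0"
proof -
  define v where "v = 2 / (1 - gaussian_walk.rate (b - (mu1 - \<gamma>)) \<sigma>)\<^sup>2"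
  define C where "C = greedyC ((b - (mu1 - \<gamma>)) / \<sigma>)"
  have moments: "integrable M (\<lambda>\<omega>. (real (passage b i \<omega>))\<^sup>2)" "expectation (\<lambda>\<omega>. (real (passage b i \<omega>))\<^sup>2) \<le> v"
    "expectation (\<lambda>\<omega>. real (passage b i \<omega>)) = C" if "1 \<le> i" for i
  proof -
    interpret w: gaussian_walk M "\<lambda>j \<omega>. X i j \<omega> - b" "b - (mu1 - \<gamma>)" \<sigma>
      by (rule other_walk[OF that assms(1)])
    show "integrable M (\<lambda>\<omega>. (real (passage b i \<omega>))\<^sup>2)" "expectation (\<lambda>\<omega>. (real (passage b i \<omega>))\<^sup>2) \<le> v"
      "expectation (\<lambda>\<omega>. real (passage b i \<omega>)) = C"
      unfolding passage_def v_def C_def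
      using w.first_passage_square_expectation w.first_passage_expectation by simp_all
  qed
  have "0 \<le> v" by (simp add: v_def)
  have bound: "norm (prob {\<omega> \<in> space M. \<eta> * real k \<le> \<bar>real (total_passage b k \<omega>) - real (k - 1) * C\<bar>}) \<le> v / \<eta>\<^sup>2 * inverse (real k)"
    if "1 \<le> k" for k
  proof -
    have "prob {\<omega> \<in> space M. \<eta> * real k \<le> \<bar>(\<Sum>i\<in>{1..<k}. real (passage b i \<omega>)) - real (card {1..<k}) * C\<bar>}
        \<le> real (card {1..<k}) * v / (\<eta> * real k)\<^sup>2"
      using that assms(2) by (intro weak_law_bound indep_vars_subset[OF indep_passage] moments) auto
    also have "\<dots> \<le> real k * v / (\<eta> * real k)\<^sup>2"
      using \<open>0 \<le> v\<close> by (intro divide_right_mono mult_right_mono) auto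
    also have "\<dots> = v / \<eta>\<^sup>2 * inverse (real k)"
      using that assms(2) by (simp add: power2_eq_square field_simps)
    finally show ?thesis by (simp add: total_passage_def)
  qed
  show ?thesis
    unfolding C_def[symmetric]
  proof (rule Lim_null_comparison)
    show "eventually (\<lambda>k. norm (prob {\<omega> \<in> space M. \<eta> * real k \<le> \<bar>real (total_passage b k \<omega>) - real (k - 1) * C\<bar>})
        \<le> v / \<eta>\<^sup>2 * inverse (real k)) sequentially"
      by (rule eventually_mono[OF eventually_ge_at_top[of 1] bound])
    show "(\<lambda>k. v / \<eta>\<^sup>2 * inverse (real k)) \<longlonglongrightarrow> 0"
      by (intro tendsto_mult_right_zero lim_inverse_n)
  qed
qed

lemma total_passage_not_large:
  assumes "mu1 - \<gamma> < b" "greedyC ((b - (mu1 - \<gamma>)) / \<sigma>) < \<theta>"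
  shows "(\<lambda>k. prob {\<omega> \<in> space M. \<theta> * real k \<le> real (total_passage b k \<omega>)}) \<longlonglongrightarrow> 0"
proof (rule Lim_null_comparison)
  define C where "C = greedyC ((b - (mu1 - \<gamma>)) / \<sigma>)"
  show "(\<lambda>k. prob {\<omega> \<in> space M. (\<theta> - C) * real k \<le> \<bar>real (total_passage b k \<omega>) - real (k - 1) * C\<bar>}) \<longlonglongrightarrow> 0"
    unfolding C_def by (rule total_passage_weak_law) (use assms in auto)
  have "0 < C" by (simp add: C_def greedyC_pos)
  have "prob {\<omega> \<in> space M. \<theta> * real k \<le> real (total_passage b k \<omega>)}
    \<le> prob {\<omega> \<in> space M. (\<theta> - C) * real k \<le> \<bar>real (total_passage b k \<omega>) - real (k - 1) * C\<bar>}" for k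
  proof (rule finite_measure_mono)
    have "real (k - 1) * C \<le> real k * C" using \<open>0 < C\<close> by (intro mult_right_mono) auto
    then show "{\<omega> \<in> space M. \<theta> * real k \<le> real (total_passage b k \<omega>)}
      \<subseteq> {\<omega> \<in> space M. (\<theta> - C) * real k \<le> \<bar>real (total_passage b k \<omega>) - real (k - 1) * C\<bar>}"
      by (auto simp: algebra_simps)
  qed measurable
  then show "eventually (\<lambda>k. norm (prob {\<omega> \<in> space M. \<theta> * real k \<le> real (total_passage b k \<omega>)})
    \<le> prob {\<omega> \<in> space M. (\<theta> - C) * real k \<le> \<bar>real (total_passage b k \<omega>) - real (k - 1) * C\<bar>}) sequentially"
    by simp
qed

lemma total_passage_not_small:
  assumes "mu1 - \<gamma> < b" "\<theta> < greedyC ((b - (mu1 - \<gamma>)) / \<sigma>)"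
  shows "(\<lambda>k. prob {\<omega> \<in> space M. real (total_passage b k \<omega>) \<le> \<theta> * real k}) \<longlonglongrightarrow> 0"
proof (rule Lim_null_comparison)
  define C where "C = greedyC ((b - (mu1 - \<gamma>)) / \<sigma>)"
  \<comment> \<open>Half of the margin is kept as deviation; the other half absorbs the missing
    summand \<open>C\<close> once \<open>C \<le> \<eta> * k\<close>.\<close>
  define \<eta> where "\<eta> = (C - \<theta>) / 2"
  have "0 < \<eta>" using assms by (simp add: \<eta>_def C_def)
  show "(\<lambda>k. prob {\<omega> \<in> space M. \<eta> * real k \<le> \<bar>real (total_passage b k \<omega>) - real (k - 1) * C\<bar>}) \<longlonglongrightarrow> 0"
    unfolding C_def by (rule total_passage_weak_law[OF assms(1) \<open>0 < \<eta>\<close>])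
  have "eventually (\<lambda>k. 1 \<le> k \<and> C / \<eta> \<le> real k) sequentially"
    using eventually_ge_at_top[of 1] filterlim_real_sequentially
    by (auto simp: filterlim_at_top intro: eventually_conj)
  then show "eventually (\<lambda>k. norm (prob {\<omega> \<in> space M. real (total_passage b k \<omega>) \<le> \<theta> * real k})
    \<le> prob {\<omega> \<in> space M. \<eta> * real k \<le> \<bar>real (total_passage b k \<omega>) - real (k - 1) * C\<bar>}) sequentially"
  proof eventually_elim
    case (elim k)
    have "C \<le> \<eta> * real k" using elim \<open>0 < \<eta>\<close> by (simp add: divide_le_eq mult.commute)
    moreover have "real (k - 1) * C = real k * C - C" using elim by (simp add: of_nat_diff algebra_simps)
    moreover have "2 * (\<eta> * real k) = real k * C - \<theta> * real k"
    proof -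
      have "2 * \<eta> = C - \<theta>" by (simp add: \<eta>_def)
      then have "2 * \<eta> * real k = (C - \<theta>) * real k" by simp
      then show ?thesis by (simp add: algebra_simps)
    qed
    ultimately have "{\<omega> \<in> space M. real (total_passage b k \<omega>) \<le> \<theta> * real k}
      \<subseteq> {\<omega> \<in> space M. \<eta> * real k \<le> \<bar>real (total_passage b k \<omega>) - real (k - 1) * C\<bar>}"
      by (auto simp: abs_le_iff)
    then show ?case by (simp add: finite_measure_mono)
  qed
qed

end

section \<open>The limit of the probability of correct selection\<close>

text \<open>These events decrease to the empty set. The use is to replace a random time of index 0
  by a deterministic \<open>L\<close> that does not depend on \<open>k\<close>.\<close>

lemma (in prob_space) prob_late_witness_tendsto_0:
  assumes [measurable]: "\<And>n. Measurable.pred M (P n)"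
  shows "(\<lambda>L. prob {\<omega> \<in> space M. (\<exists>n. P n \<omega>) \<and> \<not> (\<exists>n\<le>L. P n \<omega>)}) \<longlonglongrightarrow> 0"
proof -
  define E where "E L = {\<omega> \<in> space M. (\<exists>n. P n \<omega>) \<and> \<not> (\<exists>n\<le>L. P n \<omega>)}" for L :: nat
  have "range E \<subseteq> sets M" unfolding E_def by auto
  moreover have "decseq E" unfolding E_def decseq_def by force
  ultimately have "(\<lambda>L. prob (E L)) \<longlonglongrightarrow> prob (\<Inter>L. E L)"
    by (rule finite_Lim_measure_decseq)
  moreover have "(\<Inter>L. E L) = {}" unfolding E_def by blast
  ultimately show ?thesis by (simp add: E_def)
qed

lemma budget_bounds:
  assumes "1 \<le> (c::real)"
  shows "k \<le> nat \<lfloor>c * real k\<rfloor>" "real (nat \<lfloor>c * real k\<rfloor>) \<le> c * real k" "c * real k - 1 < real (nat \<lfloor>c * real k\<rfloor>)"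
proof -
  have "real k \<le> c * real k" using mult_right_mono[OF assms, of "real k"] by simp
  then have "int k \<le> \<lfloor>c * real k\<rfloor>" by (simp add: le_floor_iff)
  then show "k \<le> nat \<lfloor>c * real k\<rfloor>" by linarith
  have "real (nat \<lfloor>c * real k\<rfloor>) = of_int \<lfloor>c * real k\<rfloor>"
    using \<open>int k \<le> \<lfloor>c * real k\<rfloor>\<close> by simp
  then show "real (nat \<lfloor>c * real k\<rfloor>) \<le> c * real k" "c * real k - 1 < real (nat \<lfloor>c * real k\<rfloor>)"
    by - linarith+
qed

text \<open>A fixed number \<open>L\<close> of observations is negligible against a linear surplus;
  the 1 is the loss from rounding the budget down.\<close>

lemma eventually_linear_gap:
  assumes "\<theta> < (c::real)"
  shows "eventually (\<lambda>k. real L + \<theta> * real k < c * real k - 1) sequentially"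
proof -
  have "eventually (\<lambda>k. (real L + 2) / (c - \<theta>) \<le> real k) sequentially"
    using filterlim_real_sequentially by (auto simp: filterlim_at_top)
  then show ?thesis
  proof eventually_elim
    case (elim k)
    then have "real L + 2 \<le> real k * (c - \<theta>)" using assms by (simp add: divide_le_eq)
    then show ?case by (simp add: algebra_simps)
  qed
qed

context selection_model
begin

lemma PCS_event_measurable [measurable]:
  "{\<omega> \<in> space M. greedy_select (\<lambda>i j. X i j \<omega>) k B = 0} \<in> sets M"
  using greedy_select_measurable[of X M k B 0] by (simp add: pred_def)

text \<open>At this level \<open>b\<close> the passages of the other alternatives leave a linear
  surplus of the budget. When index 0 stays above \<open>b\<close>, selection can fail only if its
  minimum comes after \<open>L\<close> or the total passage time reaches
  \<open>\<theta> * k\<close>.\<close>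

lemma PCS_eventually_ge:
  assumes b: "mu1 - \<gamma> < b" "b < mu1" and c: "1 \<le> c" "greedyC ((b - (mu1 - \<gamma>)) / \<sigma>) < c" and e: "0 < e"
  shows "eventually (\<lambda>k. 1 / greedyC ((mu1 - b) / \<sigma>) - e \<le> PCS M X k (nat \<lfloor>c * real k\<rfloor>)) sequentially"
proof -
  \<comment> \<open>The gap between \<open>\<theta>\<close> and \<open>c\<close> is the surplus that
    pays for the first \<open>L\<close> observations of index 0.\<close>
  obtain \<theta> where \<theta>: "greedyC ((b - (mu1 - \<gamma>)) / \<sigma>) < \<theta>" "\<theta> < c" using c dense by blast
  define P where "P J \<omega> \<longleftrightarrow> 1 \<le> J \<and> (\<forall>n\<ge>1. Xm 0 J \<omega> \<le> Xm 0 n \<omega>)" for J :: nat and \<omega>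
  have [measurable]: "Measurable.pred M (P J)" for J unfolding P_def by measurable
  define D where "D L = {\<omega> \<in> space M. (\<exists>n. P n \<omega>) \<and> \<not> (\<exists>n\<le>L. P n \<omega>)}" for L :: nat
  define T where "T k = {\<omega> \<in> space M. \<theta> * real k \<le> real (total_passage b k \<omega>)}" for k
  define G where "G = {\<omega> \<in> space M. \<forall>n\<ge>1. b < Xm 0 n \<omega>}"
  define S where "S k = {\<omega> \<in> space M. greedy_select (\<lambda>i j. X i j \<omega>) k (nat \<lfloor>c * real k\<rfloor>) = 0}" for k
  have [measurable]: "D L \<in> sets M" "T k \<in> sets M" "S k \<in> sets M" for L k
    unfolding D_def T_def S_def by measurable
  have "(\<lambda>L. prob (D L)) \<longlonglongrightarrow> 0" unfolding D_def by (rule prob_late_witness_tendsto_0) measurable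
  then have "eventually (\<lambda>L. prob (D L) < e / 2) sequentially" using e by (intro order_tendstoD) auto
  then obtain L where L: "prob (D L) < e / 2" by (auto simp: eventually_sequentially)
  have "eventually (\<lambda>k. prob (T k) < e / 2) sequentially"
    using total_passage_not_large[OF b(1) \<theta>(1)] e unfolding T_def by (intro order_tendstoD) auto
  then show ?thesis
    using eventually_linear_gap[OF \<theta>(2), of L] eventually_ge_at_top[of 1]
  proof eventually_elim
    case (elim k)
    have "AE \<omega> in M. \<omega> \<in> G \<longrightarrow> \<omega> \<in> S k \<union> (D L \<union> T k)"
      using AE_best_attains_min AE_passage_exists[OF b(1)] AE_space
    proof eventually_elim
      fix \<omega>
      assume min: "\<exists>J\<ge>1. \<forall>n\<ge>1. Xm 0 J \<omega> \<le> Xm 0 n \<omega>"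
        and pass: "\<forall>i\<ge>1. 1 \<le> passage b i \<omega> \<and> Xm i (passage b i \<omega>) \<omega> \<le> b"
        and \<omega>: "\<omega> \<in> space M"
      show "\<omega> \<in> G \<longrightarrow> \<omega> \<in> S k \<union> (D L \<union> T k)"
      proof (intro impI, rule ccontr)
        assume "\<omega> \<in> G" and no: "\<omega> \<notin> S k \<union> (D L \<union> T k)"
        have "\<exists>J. P J \<omega>" using min by (auto simp: P_def)
        then obtain J where J: "J \<le> L" "P J \<omega>" using no \<omega> by (auto simp: D_def)
        have "real (total_passage b k \<omega>) < \<theta> * real k" using no \<omega> by (auto simp: T_def)
        then have "real (J + total_passage b k \<omega>) < real (nat \<lfloor>c * real k\<rfloor>)"
          using of_nat_mono[OF J(1), where 'a = real] elim(2) budget_bounds(3)[OF c(1), of k]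
          unfolding of_nat_add by linarith
        then have "J + total_passage b k \<omega> < nat \<lfloor>c * real k\<rfloor>" by linarith
        then have "greedy_select (\<lambda>i j. X i j \<omega>) k (nat \<lfloor>c * real k\<rfloor>) = 0"
          using elim(3) budget_bounds(1)[OF c(1)] J(2) \<open>\<omega> \<in> G\<close> pass
          by (intro greedy_select_correct[where J = J and b = b and N = "\<lambda>i. passage b i \<omega>"])
            (auto simp: P_def G_def total_passage_def)
        then show False using no \<omega> by (auto simp: S_def)
      qed
    qed
    then have "prob G \<le> prob (S k \<union> (D L \<union> T k))" by (rule finite_measure_mono_AE) measurable
    also have "\<dots> \<le> prob (S k) + prob (D L \<union> T k)" by (rule measure_Un_le) measurable
    also have "\<dots> \<le> prob (S k) + (prob (D L) + prob (T k))"
      by (intro add_left_mono measure_Un_le) measurable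
    finally have "prob G - e \<le> prob (S k)" using L elim(1) by linarith
    then show ?case
      using prob_best_above[OF b(2)] by (simp add: G_def S_def PCS_def)
  qed
qed

text \<open>Suppose index 0 drops below \<open>a\<close> but never has a mean in the band from
  \<open>a\<close> to \<open>b'\<close>. Correct selection then needs the passages to
  \<open>a\<close> to fit into the budget, or \<open>J\<close> observations together with the
  passages to \<open>b\<close> to exhaust it; both are unlikely for large \<open>k\<close>. Taking
  \<open>b'\<close> above \<open>b\<close> makes the means beyond the band strictly larger than
  \<open>b\<close>.\<close>

lemma PCS_eventually_le:
  assumes a: "mu1 - \<gamma> < a" "a < b" "b < b'" "b' < mu1"
    and c: "1 \<le> c" "greedyC ((b - (mu1 - \<gamma>)) / \<sigma>) < c" "c < greedyC ((a - (mu1 - \<gamma>)) / \<sigma>)" and e: "0 < e"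
  shows "eventually (\<lambda>k. PCS M X k (nat \<lfloor>c * real k\<rfloor>) \<le>
    1 / greedyC ((mu1 - a) / \<sigma>) + (Phi_sum ((mu1 - b') / \<sigma>) - Phi_sum ((mu1 - a) / \<sigma>)) + e) sequentially"
proof -
  obtain \<theta> where \<theta>: "greedyC ((b - (mu1 - \<gamma>)) / \<sigma>) < \<theta>" "\<theta> < c" using c dense by blast
  define P where "P J \<omega> \<longleftrightarrow> 1 \<le> J \<and> Xm 0 J \<omega> < a" for J :: nat and \<omega>
  have [measurable]: "Measurable.pred M (P J)" for J unfolding P_def by measurable
  define D where "D L = {\<omega> \<in> space M. (\<exists>n. P n \<omega>) \<and> \<not> (\<exists>n\<le>L. P n \<omega>)}" for L :: nat
  define T where "T k = {\<omega> \<in> space M. \<theta> * real k \<le> real (total_passage b k \<omega>)}" for k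
  define T' where "T' k = {\<omega> \<in> space M. real (total_passage a k \<omega>) \<le> c * real k}" for k
  define G where "G = {\<omega> \<in> space M. \<forall>n\<ge>1. a \<le> Xm 0 n \<omega>}"
  define H where "H = {\<omega> \<in> space M. \<exists>n\<ge>1. a \<le> Xm 0 n \<omega> \<and> Xm 0 n \<omega> < b'}"
  define S where "S k = {\<omega> \<in> space M. greedy_select (\<lambda>i j. X i j \<omega>) k (nat \<lfloor>c * real k\<rfloor>) = 0}" for k
  have [measurable]: "D L \<in> sets M" "T k \<in> sets M" "T' k \<in> sets M" "S k \<in> sets M" "G \<in> sets M" "H \<in> sets M" for L k
    unfolding D_def T_def T'_def S_def G_def H_def by measurable
  have "(\<lambda>L. prob (D L)) \<longlonglongrightarrow> 0" unfolding D_def by (rule prob_late_witness_tendsto_0) measurable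
  then have "eventually (\<lambda>L. prob (D L) < e / 3) sequentially" using e by (intro order_tendstoD) auto
  then obtain L where L: "prob (D L) < e / 3" by (auto simp: eventually_sequentially)
  have bg: "mu1 - \<gamma> < b" using a by simp
  have "eventually (\<lambda>k. prob (T k) < e / 3) sequentially"
    using total_passage_not_large[OF bg \<theta>(1)] e unfolding T_def by (intro order_tendstoD) auto
  moreover have "eventually (\<lambda>k. prob (T' k) < e / 3) sequentially"
    using total_passage_not_small[OF a(1) c(3)] e unfolding T'_def by (intro order_tendstoD) auto
  ultimately show ?thesis
    using eventually_linear_gap[OF \<theta>(2), of L] eventually_ge_at_top[of 1]
  proof eventually_elim
    case (elim k)
    have "AE \<omega> in M. \<omega> \<in> S k \<longrightarrow> \<omega> \<in> G \<union> (H \<union> (D L \<union> (T k \<union> T' k)))"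
      using AE_passage_exists[OF bg] AE_space
    proof eventually_elim
      fix \<omega>
      assume pass: "\<forall>i\<ge>1. 1 \<le> passage b i \<omega> \<and> Xm i (passage b i \<omega>) \<omega> \<le> b"
        and \<omega>: "\<omega> \<in> space M"
      show "\<omega> \<in> S k \<longrightarrow> \<omega> \<in> G \<union> (H \<union> (D L \<union> (T k \<union> T' k)))"
      proof (intro impI, rule ccontr)
        assume "\<omega> \<in> S k" and no: "\<omega> \<notin> G \<union> (H \<union> (D L \<union> (T k \<union> T' k)))"
        have "\<exists>J. P J \<omega>" using no \<omega> by (auto simp: G_def P_def not_le)
        then obtain J where J: "J \<le> L" "P J \<omega>" using no \<omega> by (auto simp: D_def)
        have gap: "Xm 0 n \<omega> < a \<or> b < Xm 0 n \<omega>" if "1 \<le> n" for n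
          using no \<omega> that a(3) unfolding H_def by (fastforce simp: not_le not_less)
        have "(\<Sum>i\<in>{1..<k}. passage a i \<omega>) \<le> nat \<lfloor>c * real k\<rfloor> \<or>
            nat \<lfloor>c * real k\<rfloor> \<le> J + (\<Sum>i\<in>{1..<k}. passage b i \<omega>)"
        proof (rule greedy_select_correct_bounds)
          show "greedy_select (\<lambda>i j. X i j \<omega>) k (nat \<lfloor>c * real k\<rfloor>) = 0"
            using \<open>\<omega> \<in> S k\<close> by (simp add: S_def)
        qed (use elim budget_bounds(1)[OF c(1)] J(2) pass gap passage_le in \<open>auto simp: P_def\<close>)
        then show False
        proof
          assume "(\<Sum>i\<in>{1..<k}. passage a i \<omega>) \<le> nat \<lfloor>c * real k\<rfloor>"
          then have "real (total_passage a k \<omega>) \<le> real (nat \<lfloor>c * real k\<rfloor>)"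
            unfolding total_passage_def by (simp only: of_nat_le_iff)
          then have "real (total_passage a k \<omega>) \<le> c * real k"
            using budget_bounds(2)[OF c(1), of k] by linarith
          then show False using no \<omega> by (auto simp: T'_def)
        next
          assume "nat \<lfloor>c * real k\<rfloor> \<le> J + (\<Sum>i\<in>{1..<k}. passage b i \<omega>)"
          then have "real (nat \<lfloor>c * real k\<rfloor>) \<le> real (J + total_passage b k \<omega>)"
            unfolding total_passage_def by (simp only: of_nat_le_iff)
          moreover have "real (total_passage b k \<omega>) < \<theta> * real k" using no \<omega> by (auto simp: T_def)
          ultimately show False
            using of_nat_mono[OF J(1), where 'a = real] elim(3) budget_bounds(3)[OF c(1), of k]
            unfolding of_nat_add by linarith
        qed
      qed
    qed
    then have "prob (S k) \<le> prob (G \<union> (H \<union> (D L \<union> (T k \<union> T' k))))" by (rule finite_measure_mono_AE) measurable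
    also have "\<dots> \<le> prob G + prob (H \<union> (D L \<union> (T k \<union> T' k)))" by (rule measure_Un_le) measurable
    also have "\<dots> \<le> prob G + (prob H + prob (D L \<union> (T k \<union> T' k)))"
      by (intro add_left_mono measure_Un_le) measurable
    also have "\<dots> \<le> prob G + (prob H + (prob (D L) + prob (T k \<union> T' k)))"
      by (intro add_left_mono measure_Un_le) measurable
    also have "\<dots> \<le> prob G + (prob H + (prob (D L) + (prob (T k) + prob (T' k))))"
      by (intro add_left_mono measure_Un_le) measurable
    finally have "prob (S k) \<le> prob G + prob H + e" using L elim(1,2) by linarith
    moreover have "prob G = 1 / greedyC ((mu1 - a) / \<sigma>)"
      unfolding G_def using a by (intro prob_best_at_least) simp
    moreover have "prob H \<le> Phi_sum ((mu1 - b') / \<sigma>) - Phi_sum ((mu1 - a) / \<sigma>)"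
      unfolding H_def using a by (intro prob_best_touches) simp_all
    ultimately show ?case by (simp add: S_def PCS_def)
  qed
qed

lemma tendsto_at_right_0_comp:
  assumes "isCont f ((x::real) / \<sigma>)"
  shows "((\<lambda>\<epsilon>. (f ((x + r * \<epsilon>) / \<sigma>) :: real)) \<longlongrightarrow> f (x / \<sigma>)) (at_right 0)"
proof (rule isCont_tendsto_compose[OF assms])
  have "((\<lambda>\<epsilon>. (x + r * \<epsilon>) / \<sigma>) \<longlongrightarrow> (x + r * 0) / \<sigma>) (at_right 0)"
    by (intro tendsto_intros) (use \<sigma>_pos in auto)
  then show "((\<lambda>\<epsilon>. (x + r * \<epsilon>) / \<sigma>) \<longlongrightarrow> x / \<sigma>) (at_right 0)" by simp
qed

text \<open>The two one-sided bounds are applied at levels within \<open>2 * \<epsilon>\<close> of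
  \<open>mu1 - \<gamma>0\<close>. By strict monotonicity of \<open>greedyC\<close>, \<open>c\<close>
  separates the values for levels above and below, and continuity closes the gap as
  \<open>\<epsilon>\<close> tends to 0.\<close>

theorem PCS_tendsto:
  assumes \<gamma>0: "0 < \<gamma>0" "\<gamma>0 < \<gamma>" and c: "greedyC ((\<gamma> - \<gamma>0) / \<sigma>) = c"
  shows "(\<lambda>k. PCS M X k (nat \<lfloor>c * real k\<rfloor>)) \<longlonglongrightarrow> 1 / greedyC (\<gamma>0 / \<sigma>)"
proof -
  have c1: "1 \<le> c" using greedyC_ge_1[of "(\<gamma> - \<gamma>0) / \<sigma>"] \<gamma>0 \<sigma>_pos c by simp
  have x: "0 < \<gamma>0 / \<sigma>" using \<gamma>0 \<sigma>_pos by simp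
  have C: "isCont (\<lambda>x. 1 / greedyC x) (\<gamma>0 / \<sigma>)"
    using greedyC_pos[of "\<gamma>0 / \<sigma>"] by (intro isCont_divide isCont_greedyC x continuous_const) simp
  \<comment> \<open>The bound by \<open>\<gamma>0 / 4\<close> keeps even the level
    \<open>mu1 - \<gamma>0 + 2 * \<epsilon>\<close> below \<open>mu1\<close>; the other bound keeps
    \<open>mu1 - \<gamma>0 - \<epsilon>\<close> above \<open>mu1 - \<gamma>\<close>.\<close>
  have small: "eventually (\<lambda>\<epsilon>. 0 < \<epsilon> \<and> \<epsilon> < \<gamma>0 / 4 \<and> \<epsilon> < (\<gamma> - \<gamma>0) / 4) (at_right 0)"
    by (rule eventually_at_rightI[of 0 "min (\<gamma>0 / 4) ((\<gamma> - \<gamma>0) / 4)"]) (use \<gamma>0 in auto)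
  have C_less: "greedyC ((\<gamma> - \<gamma>0 + \<epsilon>) / \<sigma>) < c" if "0 < \<epsilon>" for \<epsilon>
    unfolding c[symmetric] using that \<gamma>0 \<sigma>_pos by (intro greedyC_strict_antimono) (auto simp: divide_strict_right_mono)
  have C_greater: "c < greedyC ((\<gamma> - \<gamma>0 - \<epsilon>) / \<sigma>)" if "0 < \<epsilon>" "\<epsilon> < (\<gamma> - \<gamma>0) / 4" for \<epsilon>
    unfolding c[symmetric] using that \<gamma>0 \<sigma>_pos by (intro greedyC_strict_antimono) (auto simp: divide_strict_right_mono)
  show ?thesis
  proof (rule order_tendstoI)
    fix u assume "u < 1 / greedyC (\<gamma>0 / \<sigma>)"
    then have "eventually (\<lambda>\<epsilon>. u < 1 / greedyC ((\<gamma>0 + - 1 * \<epsilon>) / \<sigma>)) (at_right 0)"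
      by (rule order_tendstoD(1)[OF tendsto_at_right_0_comp[OF C]])
    with small have "eventually (\<lambda>\<epsilon>. 0 < \<epsilon> \<and> \<epsilon> < \<gamma>0 / 4 \<and> u < 1 / greedyC ((\<gamma>0 - \<epsilon>) / \<sigma>)) (at_right 0)"
      by eventually_elim simp
    then obtain \<epsilon> where \<epsilon>: "0 < \<epsilon>" "\<epsilon> < \<gamma>0 / 4" "u < 1 / greedyC ((\<gamma>0 - \<epsilon>) / \<sigma>)"
      using eventually_happens'[OF trivial_limit_at_right_real] by blast
    define b where "b = mu1 - \<gamma>0 + \<epsilon>"
    have b: "mu1 - b = \<gamma>0 - \<epsilon>" "b - (mu1 - \<gamma>) = \<gamma> - \<gamma>0 + \<epsilon>" by (simp_all add: b_def)
    \<comment> \<open>A value strictly in between leaves room for the error \<open>e\<close> and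
      still gives a strict inequality with \<open>u\<close>.\<close>
    obtain v where v: "u < v" "v < 1 / greedyC ((\<gamma>0 - \<epsilon>) / \<sigma>)"
      using dense[OF \<epsilon>(3)] by blast
    define e where "e = 1 / greedyC ((\<gamma>0 - \<epsilon>) / \<sigma>) - v"
    have e: "0 < e" "u < 1 / greedyC ((\<gamma>0 - \<epsilon>) / \<sigma>) - e"
      using v by (simp_all add: e_def)
    have "eventually (\<lambda>k. 1 / greedyC ((mu1 - b) / \<sigma>) - e \<le> PCS M X k (nat \<lfloor>c * real k\<rfloor>)) sequentially"
    proof (rule PCS_eventually_ge)
      show "greedyC ((b - (mu1 - \<gamma>)) / \<sigma>) < c" unfolding b by (rule C_less[OF \<epsilon>(1)])
      show "mu1 - \<gamma> < b" "b < mu1" using \<gamma>0 \<epsilon> by (simp_all add: b_def)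
    qed (fact c1 \<open>0 < e\<close>)+
    then show "eventually (\<lambda>k. u < PCS M X k (nat \<lfloor>c * real k\<rfloor>)) sequentially"
      unfolding b by eventually_elim (use e(2) in linarith)
  next
    fix u assume u: "1 / greedyC (\<gamma>0 / \<sigma>) < u"
    \<comment> \<open>The shifts \<open>\<epsilon>\<close> and \<open>- 2 * \<epsilon>\<close>
      belong to the levels \<open>a\<close> and \<open>b'\<close> chosen below; the band probability
      cancels in the limit.\<close>
    have "((\<lambda>\<epsilon>. 1 / greedyC ((\<gamma>0 + 1 * \<epsilon>) / \<sigma>) + (Phi_sum ((\<gamma>0 + - 2 * \<epsilon>) / \<sigma>) - Phi_sum ((\<gamma>0 + 1 * \<epsilon>) / \<sigma>)))
        \<longlongrightarrow> 1 / greedyC (\<gamma>0 / \<sigma>) + (Phi_sum (\<gamma>0 / \<sigma>) - Phi_sum (\<gamma>0 / \<sigma>))) (at_right 0)"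
      by (intro tendsto_add tendsto_diff tendsto_at_right_0_comp[OF C] tendsto_at_right_0_comp[OF isCont_Phi_sum[OF x]])
    then have "eventually (\<lambda>\<epsilon>. 1 / greedyC ((\<gamma>0 + 1 * \<epsilon>) / \<sigma>) +
        (Phi_sum ((\<gamma>0 + - 2 * \<epsilon>) / \<sigma>) - Phi_sum ((\<gamma>0 + 1 * \<epsilon>) / \<sigma>)) < u) (at_right 0)"
      by (rule order_tendstoD(2)) (use u in simp)
    with small have "eventually (\<lambda>\<epsilon>. 0 < \<epsilon> \<and> \<epsilon> < \<gamma>0 / 4 \<and> \<epsilon> < (\<gamma> - \<gamma>0) / 4 \<and> 1 / greedyC ((\<gamma>0 + \<epsilon>) / \<sigma>) +
        (Phi_sum ((\<gamma>0 - 2 * \<epsilon>) / \<sigma>) - Phi_sum ((\<gamma>0 + \<epsilon>) / \<sigma>)) < u) (at_right 0)"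
      by eventually_elim simp
    then obtain \<epsilon> where \<epsilon>: "0 < \<epsilon>" "\<epsilon> < \<gamma>0 / 4" "\<epsilon> < (\<gamma> - \<gamma>0) / 4" and
      lt: "1 / greedyC ((\<gamma>0 + \<epsilon>) / \<sigma>) + (Phi_sum ((\<gamma>0 - 2 * \<epsilon>) / \<sigma>) - Phi_sum ((\<gamma>0 + \<epsilon>) / \<sigma>)) < u"
      using eventually_happens'[OF trivial_limit_at_right_real] by blast
    define a where "a = mu1 - \<gamma>0 - \<epsilon>"
    define b where "b = mu1 - \<gamma>0 + \<epsilon>"
    define b' where "b' = mu1 - \<gamma>0 + 2 * \<epsilon>"
    have eqs: "mu1 - a = \<gamma>0 + \<epsilon>" "mu1 - b' = \<gamma>0 - 2 * \<epsilon>" "a - (mu1 - \<gamma>) = \<gamma> - \<gamma>0 - \<epsilon>" "b - (mu1 - \<gamma>) = \<gamma> - \<gamma>0 + \<epsilon>"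
      by (simp_all add: a_def b_def b'_def)
    obtain v where v: "1 / greedyC ((\<gamma>0 + \<epsilon>) / \<sigma>) + (Phi_sum ((\<gamma>0 - 2 * \<epsilon>) / \<sigma>) - Phi_sum ((\<gamma>0 + \<epsilon>) / \<sigma>)) < v" "v < u"
      using dense[OF lt] by blast
    define e where "e = v - (1 / greedyC ((\<gamma>0 + \<epsilon>) / \<sigma>) + (Phi_sum ((\<gamma>0 - 2 * \<epsilon>) / \<sigma>) - Phi_sum ((\<gamma>0 + \<epsilon>) / \<sigma>)))"
    have "0 < e" using v(1) by (simp add: e_def)
    have "eventually (\<lambda>k. PCS M X k (nat \<lfloor>c * real k\<rfloor>) \<le>
      1 / greedyC ((mu1 - a) / \<sigma>) + (Phi_sum ((mu1 - b') / \<sigma>) - Phi_sum ((mu1 - a) / \<sigma>)) + e) sequentially"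
    proof (rule PCS_eventually_le)
      show "greedyC ((b - (mu1 - \<gamma>)) / \<sigma>) < c" unfolding eqs by (rule C_less[OF \<epsilon>(1)])
      show "c < greedyC ((a - (mu1 - \<gamma>)) / \<sigma>)" unfolding eqs by (rule C_greater[OF \<epsilon>(1,3)])
      show "mu1 - \<gamma> < a" using \<gamma>0 \<epsilon> unfolding a_def by argo
      show "a < b" "b < b'" "b' < mu1" using \<epsilon> by (simp_all add: a_def b_def b'_def)
    qed (fact c1 \<open>0 < e\<close>)+
    then show "eventually (\<lambda>k. PCS M X k (nat \<lfloor>c * real k\<rfloor>) < u) sequentially"
    proof eventually_elim
      case (elim k)
      have "1 / greedyC ((mu1 - a) / \<sigma>) + (Phi_sum ((mu1 - b') / \<sigma>) - Phi_sum ((mu1 - a) / \<sigma>)) + e < u"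
        unfolding eqs e_def using v(2) by simp
      with elim show ?case by linarith
    qed
  qed
qed

end

theorem theorem2:
  fixes M :: "'a measure" and X :: "nat \<Rightarrow> nat \<Rightarrow> 'a \<Rightarrow> real"
    and mu1 \<gamma> \<sigma> c :: real
  assumes "prob_space M"
    and "prob_space.indep_vars M (\<lambda>_. borel) (\<lambda>p. X (fst p) (snd p)) UNIV"
    and "\<And>j. distributed M lborel (X 0 j) (normal_density mu1 \<sigma>)"
    and "\<And>i j. i \<ge> 1 \<Longrightarrow> distributed M lborel (X i j) (normal_density (mu1 - \<gamma>) \<sigma>)"
    and "\<gamma> > 0" and "\<sigma> > 0"
    and "c > greedyC (\<gamma> / \<sigma>)"
  shows "(\<exists>!\<gamma>0. 0 < \<gamma>0 \<and> \<gamma>0 < \<gamma> \<and> greedyC ((\<gamma> - \<gamma>0) / \<sigma>) = c)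
    \<and> (\<forall>\<gamma>0. 0 < \<gamma>0 \<and> \<gamma>0 < \<gamma> \<and> greedyC ((\<gamma> - \<gamma>0) / \<sigma>) = c \<longrightarrow>
         ((\<lambda>k. PCS M X k (nat \<lfloor>c * real k\<rfloor>)) \<longlonglongrightarrow>
            measure M {\<omega> \<in> space M. \<forall>n\<ge>1. sample_mean (\<lambda>i j. X i j \<omega>) 0 n > mu1 - \<gamma>0})
       \<and> measure M {\<omega> \<in> space M. \<forall>n\<ge>1. sample_mean (\<lambda>i j. X i j \<omega>) 0 n > mu1 - \<gamma>0}
           = 1 / greedyC (\<gamma>0 / \<sigma>))"
proof -
  interpret prob_space M by fact
  interpret selection_model M X mu1 \<gamma> \<sigma>
    by unfold_locales (fact assms)+
  have "0 < \<gamma> / \<sigma>" using assms(5,6) by simp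
  \<comment> \<open>As \<open>c\<close> exceeds the value at \<open>\<gamma> / \<sigma>\<close>, it
    is attained at some smaller \<open>x\<close>; solving
    \<open>(\<gamma> - \<gamma>0) / \<sigma> = x\<close> gives the witness
    \<open>\<gamma> - x * \<sigma>\<close>.\<close>
  then obtain x where x: "0 < x" "x < \<gamma> / \<sigma>" "greedyC x = c"
    using greedyC_attains[OF _ assms(7)] by blast
  have "\<exists>!\<gamma>0. 0 < \<gamma>0 \<and> \<gamma>0 < \<gamma> \<and> greedyC ((\<gamma> - \<gamma>0) / \<sigma>) = c"
  proof (rule ex1I[of _ "\<gamma> - x * \<sigma>"])
    show "0 < \<gamma> - x * \<sigma> \<and> \<gamma> - x * \<sigma> < \<gamma> \<and> greedyC ((\<gamma> - (\<gamma> - x * \<sigma>)) / \<sigma>) = c"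
      using x \<open>\<sigma> > 0\<close> by (simp add: pos_less_divide_eq)
    fix g assume g: "0 < g \<and> g < \<gamma> \<and> greedyC ((\<gamma> - g) / \<sigma>) = c"
    then have "0 < (\<gamma> - g) / \<sigma>" using \<open>\<sigma> > 0\<close> by simp
    then have "(\<gamma> - g) / \<sigma> = x"
      by (rule greedyC_eq_unique) (use x g in simp_all)
    then have "\<gamma> - g = x * \<sigma>" using \<open>\<sigma> > 0\<close> by (simp add: divide_eq_eq)
    then show "g = \<gamma> - x * \<sigma>" by linarith
  qed
  moreover have "prob {\<omega> \<in> space M. \<forall>n\<ge>1. Xm 0 n \<omega> > mu1 - g} = 1 / greedyC (g / \<sigma>)" if "0 < g" for g
    using prob_best_above[of "mu1 - g"] that by simp
  ultimately show ?thesis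
    using PCS_tendsto by (intro conjI allI impI) (simp_all only:)
qed

end
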